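(* Let $p$ be an odd prime, $n\ge 1$ and $k\geq 2$ integers, let $f_0,\dots,f_{k-1}:\mathbb{Z}_p^n\to\mathbb{Z}_p$, and let $f:\mathbb{Z}_p^n\to\mathbb{Z}_{p^k}$ be given by $f(\mathbf{x})=\sum_{i=0}^{k-1}f_i(\mathbf{x})p^{k-1-i}$. Then $f$ is gbent if and only if for every $\mathbf{u}\in\mathbb{Z}_p^n$ there exist $\mathbf{v}\in\mathbb{Z}_p^{k-1}$, $j\in\mathbb{Z}_p$ and a sign $\epsilon\in\{1,-1\}$ such that for all $\mathbf{a}=(a_1,\dots,a_{k-1})\in\mathbb{Z}_p^{k-1}$, $$\mathcal{H}_{f_0+\sum_{i=1}^{k-1}a_if_i}(\mathbf{u})=\begin{cases}\epsilon\,\zeta_p^{\mathbf{v}\cdot\mathbf{a}+j} & \text{if } n \text{ is even, or } n \text{ is odd and } p\equiv 1\pmod 4,\\ \epsilon\sqrt{-1}\,\zeta_p^{\mathbf{v}\cdot\mathbf{a}+j} & \text{if } n\text{ is odd and } p\equiv 3\pmod 4.\end{cases}$$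
   Context: For a positive integer $m$, $\mathbb{Z}_m$ is the ring of integers modulo $m$ and $\zeta_m=e^{2\pi\sqrt{-1}/m}$. The dot denotes the standard inner product modulo $p$ of vectors over $\mathbb{Z}_p$. For a positive integer $q$ divisible by $p$ and $g:\mathbb{Z}_p^n\to\mathbb{Z}_q$, the generalized Walsh-Hadamard transform is $\mathcal{H}_g(\mathbf{u})=p^{-n/2}\sum_{\mathbf{x}\in\mathbb{Z}_p^n}\zeta_p^{-\mathbf{u}\cdot\mathbf{x}}\zeta_q^{g(\mathbf{x})}$; $g$ is called gbent if $|\mathcal{H}_g(\mathbf{u})|=1$ for all $\mathbf{u}\in\mathbb{Z}_p^n$. For $f$ one takes $q=p^k$; for $f_0+\sum_{i=1}^{k-1} a_if_i:\mathbb{Z}_p^n\to\mathbb{Z}_p$ (computed modulo $p$) one takes $q=p$. In the formula for $f$, the values $f_i(\mathbf{x})\in\mathbb{Z}_p$ are identified with their representatives in $\{0,1,\dots,p-1\}$. *)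

theory Defs
  imports Complex_Main "HOL-Library.FuncSet" "HOL-Number_Theory.Residues"
begin

text \<open>The ring of integers modulo \<open>m\<close> is \<^term>\<open>residue_ring (int m)\<close>, whose carrier consists of the
  representatives \<open>0, \<dots>, m - 1\<close>.  A vector of length \<open>d\<close> has its coordinates indexed
  by \<open>1, \<dots>, d\<close>; extensionality makes it determined by these coordinates.\<close>

definition residue_vecs :: "nat \<Rightarrow> nat \<Rightarrow> (nat \<Rightarrow> int) set" where
  "residue_vecs m d = {1..d} \<rightarrow>\<^sub>E carrier (residue_ring (int m))"

definition residue_dot :: "nat \<Rightarrow> nat \<Rightarrow> (nat \<Rightarrow> int) \<Rightarrow> (nat \<Rightarrow> int) \<Rightarrow> int" where
  "residue_dot m d u x = (\<Sum>i=1..d. u i * x i) mod int m"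

definition zeta :: "nat \<Rightarrow> complex" where
  "zeta m = exp (2 * of_real pi * \<i> / of_nat m)"

text \<open>In the next two definitions \<open>p\<close> divides \<open>q\<close>, and \<open>g\<close> maps \<^term>\<open>residue_vecs p n\<close> to
  \<^term>\<open>carrier (residue_ring (int q))\<close>.\<close>

definition gwht :: "nat \<Rightarrow> nat \<Rightarrow> nat \<Rightarrow> ((nat \<Rightarrow> int) \<Rightarrow> int) \<Rightarrow> (nat \<Rightarrow> int) \<Rightarrow> complex" where
  "gwht p n q g u = of_real (real p powr (- real n / 2)) *
     (\<Sum>x\<in>residue_vecs p n. zeta p powi (- residue_dot p n u x) * zeta q powi g x)"

definition gbent :: "nat \<Rightarrow> nat \<Rightarrow> nat \<Rightarrow> ((nat \<Rightarrow> int) \<Rightarrow> int) \<Rightarrow> bool" where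
  "gbent p n q g \<longleftrightarrow> (\<forall>u\<in>residue_vecs p n. norm (gwht p n q g u) = 1)"

end

theory Submission
  imports Defs "HOL-Computational_Algebra.Computational_Algebra"
begin

text \<open>
  Fix \<open>u\<close> and write \<open>q = p^(k-1)\<close>, \<open>N = p^k\<close>.  In base \<open>p\<close> the value \<open>f(x)\<close> has leading digit
  \<open>f_0(x)\<close>, followed by a number \<open>r(x) < q\<close> whose digits are \<open>f_1(x), \<dots>, f_{k-1}(x)\<close>.  With
  \<open>S_e\<close> the sum of \<open>\<zeta>_p^(f_0(x) - u\<cdot>x)\<close> over all \<open>x\<close> with \<open>r(x) = e\<close>, the transform of \<open>f\<close> at \<open>u\<close> is,
  up to the factor \<open>p^(-n/2)\<close>, the number \<open>\<alpha> = \<Sum>_e S_e \<zeta>_N^e\<close>, while the transforms of the functions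
  \<open>f_0 + \<Sum> a_i f_i\<close> form the discrete Fourier transform of \<open>S\<close>, regarded as a function of the digit vector
  of \<open>e\<close>.  The condition on these transforms therefore says that \<open>S\<close> is supported on a single \<open>e\<close>,
  with value \<open>\<epsilon> \<zeta>_p^j\<close> times \<open>p^(n/2)\<close> or \<open>\<i> p^(n/2)\<close>.  This gives \<open>|\<alpha>| = p^(n/2)\<close> at once
  by Fourier inversion (\<open>character_sums_determine\<close>).

  The converse is arithmetic in \<open>\<int>[\<zeta>_N]\<close>, where \<open>p\<close> is totally ramified.  Let \<open>G\<close> be an element of
  \<open>\<int>[\<zeta>_p]\<close> with \<open>G^2 = \<plusminus>p\<close> (\<open>zeta_quadratic_root\<close>).  As the only prime above \<open>p\<close> is generated by
  \<open>\<zeta>_N - 1\<close> and is stable under conjugation, \<open>|\<alpha>|^2 = p^n\<close> forces \<open>\<alpha> = G^n \<beta>\<close> with \<open>\<beta>\<close> in \<open>\<int>[\<zeta>_N]\<close>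
  (\<open>norm_square_p_power_imp_dvd\<close>), and every conjugate of \<open>\<beta>\<close> has absolute value 1.  Then
  \<open>\<beta> = \<plusminus>\<zeta>_N^m\<close> (\<open>norm_1_imp_root_of_unity\<close>).  Writing \<open>m = j q + e\<close> gives
  \<open>\<alpha> = \<plusminus>G^n \<zeta>_p^j \<zeta>_N^e\<close>, and since \<open>1, \<zeta>_N, \<dots>, \<zeta>_N^(q-1)\<close> are linearly independent over
  \<open>\<int>[\<zeta>_p]\<close> (\<open>independent_over_zeta_p\<close>), \<open>S\<close> is supported on that single \<open>e\<close>.  The factor \<open>\<i>\<close> appears
  because \<open>G^2 = -p\<close> for \<open>p \<equiv> 3\<close> modulo 4.

  Elements of \<open>\<int>[\<zeta>_N]\<close> are represented by integer polynomials evaluated at \<open>\<zeta>_N\<close>.  Irreducibility of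
  the cyclotomic polynomial yields the two facts about this representation on which everything rests:
  a relation that holds at \<open>\<zeta>_N\<close> also holds at its conjugates (\<open>ev_conjugate\<close>), and it holds modulo
  \<open>p\<close> at 1 (\<open>p_dvd_poly_1\<close>), so that \<open>P(\<zeta>_N) \<mapsto> P(1)\<close> is a well-defined reduction to \<open>\<int>_p\<close>.
\<close>

section \<open>Integer polynomials at complex points\<close>

definition ev :: "int poly \<Rightarrow> complex \<Rightarrow> complex" where
  "ev P z = poly (map_poly of_int P) z"

lemma ev_0 [simp]: "ev 0 z = 0"
  and ev_pCons [simp]: "ev (pCons a P) z = of_int a + z * ev P z"
  by (simp_all add: ev_def map_poly_pCons)

lemma ev_1 [simp]: "ev 1 z = 1"
  by (simp add: one_pCons)

lemma ev_add [simp]: "ev (P + Q) z = ev P z + ev Q z"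
proof -
  have "map_poly of_int (P + Q) = (map_poly of_int P + map_poly of_int Q :: complex poly)"
    by (rule poly_eqI) (simp add: coeff_map_poly)
  then show ?thesis by (simp add: ev_def)
qed

lemma ev_mult [simp]: "ev (P * Q) z = ev P z * ev Q z"
proof -
  have "map_poly of_int (P * Q) = (map_poly of_int P * map_poly of_int Q :: complex poly)"
    by (rule poly_eqI) (simp add: coeff_map_poly coeff_mult)
  then show ?thesis by (simp add: ev_def)
qed

lemma ev_minus [simp]: "ev (- P) z = - ev P z"
  using ev_add[of P "- P" z] by (simp add: eq_neg_iff_add_eq_0 add.commute)

lemma ev_diff [simp]: "ev (P - Q) z = ev P z - ev Q z"
  using ev_add[of P "- Q" z] by simp

lemma ev_smult [simp]: "ev (smult c P) z = of_int c * ev P z"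
  by (induction P) (simp_all add: algebra_simps)

lemma ev_power [simp]: "ev (P ^ m) z = ev P z ^ m"
  by (induction m) simp_all

lemma ev_monom [simp]: "ev (Polynomial.monom a m) z = of_int a * z ^ m"
  by (induction m) (simp_all add: monom_0 monom_Suc)

lemma ev_sum [simp]: "ev (\<Sum>i\<in>I. P i) z = (\<Sum>i\<in>I. ev (P i) z)"
  by (induction I rule: infinite_finite_induct) simp_all

lemma ev_prod [simp]: "ev (\<Prod>i\<in>I. P i) z = (\<Prod>i\<in>I. ev (P i) z)"
  by (induction I rule: infinite_finite_induct) simp_all

lemma ev_pcompose [simp]: "ev (pcompose P Q) z = ev P (ev Q z)"
  by (induction P) (simp_all add: pcompose_pCons)

lemma ev_of_int: "ev P (of_int a) = of_int (poly P a)"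
  by (induction P) simp_all

lemma ev_at_1: "ev P 1 = of_int (poly P 1)"
  using ev_of_int[of P 1] by simp

lemma ev_of_nat [simp]: "ev (of_nat m) z = of_nat m"
  by (simp add: of_nat_poly)

lemma cnj_ev: "cnj (ev P z) = ev P (cnj z)"
  by (induction P) simp_all

section \<open>Frobenius congruences for integer polynomials\<close>

lemma prime_dvd_binomial_power:
  fixes a b :: "'a :: comm_ring_1"
  assumes "prime (p :: nat)"
  shows "of_nat p dvd (a + b) ^ p - a ^ p - b ^ p"
proof -
  have p: "p > 0" using assms prime_gt_0_nat by blast
  have "(a + b) ^ p = (\<Sum>k\<le>p. of_nat (p choose k) * a ^ k * b ^ (p - k))"
    by (rule binomial_ring)
  also have "{..p} = {1..<p} \<union> {0, p}" using p by auto
  also have "(\<Sum>k\<in>{1..<p} \<union> {0, p}. of_nat (p choose k) * a ^ k * b ^ (p - k)) =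
      (\<Sum>k\<in>{1..<p}. of_nat (p choose k) * a ^ k * b ^ (p - k)) + (b ^ p + a ^ p)"
    using p by (subst sum.union_disjoint) auto
  finally have "(a + b) ^ p - a ^ p - b ^ p = 
      (\<Sum>k\<in>{1..<p}. of_nat (p choose k) * a ^ k * b ^ (p - k))" by simp
  also have "of_nat p dvd \<dots>"
  proof (rule dvd_sum)
    fix k assume "k \<in> {1..<p}"
    then have "p dvd (p choose k)" using assms
      by (intro dvd_choose_prime) auto
    then show "of_nat p dvd of_nat (p choose k) * a ^ k * b ^ (p - k)"
      by (auto elim!: dvdE)
  qed
  finally show ?thesis .
qed

lemma prime_dvd_power_diff_self:
  fixes a :: int
  assumes "prime (p :: nat)"
  shows "int p dvd a ^ p - a"
proof -
  define r where "r = nat (a mod int p)"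
  have p: "p > 0" using prime_gt_0_nat[OF assms] .
  have r: "[a = int r] (mod int p)"
    using p by (simp add: r_def cong_def)
  have "[r ^ p = r] (mod p)"
  proof (cases "p dvd r")
    case True
    then have "p dvd r ^ p" using p by (simp add: dvd_power_same dvd_trans[OF _ dvd_power])
    with True show ?thesis by (simp add: cong_def mod_eq_0_iff_dvd)
  next
    case False
    then have "[r * r ^ (p - 1) = r * 1] (mod p)"
      using fermat_theorem[OF assms] by (intro cong_scalar_left)
    then show ?thesis using p by (simp add: power_eq_if)
  qed
  then have "[int r ^ p = int r] (mod int p)"
    by (metis cong_int_iff of_nat_power)
  with r have "[a ^ p = a] (mod int p)"
    by (meson cong_pow cong_sym cong_trans)
  then show ?thesis by (simp add: cong_iff_dvd_diff)
qed

text \<open>The freshman's dream together with Fermat's little theorem for the coefficients.\<close>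
lemma frobenius_int_poly:
  fixes P :: "int poly"
  assumes p: "prime (p :: nat)"
  shows "of_nat p dvd P ^ p - pcompose P (Polynomial.monom 1 p)"
proof (induction P)
  case 0
  then show ?case using prime_gt_0_nat[OF p] by (simp add: zero_power)
next
  case (pCons a P)
  let ?X = "Polynomial.monom 1 p :: int poly"
  let ?x = "[:0, 1:] :: int poly"
  have X: "?X = ?x ^ p"
    by (simp add: monom_altdef)
  have "pCons a P = [:a:] + ?x * P" by simp
  then have 1: "of_nat p dvd (pCons a P) ^ p - [:a:] ^ p - (?x * P) ^ p"
    using prime_dvd_binomial_power[OF p, of "[:a:]" "?x * P"] by metis
  have "of_nat p dvd [:a:] ^ p - [:a:]"
  proof -
    have "[:a:] ^ p - [:a:] = [:a ^ p - a:]"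
      by (simp add: poly_const_pow)
    moreover have "of_nat p = [:int p:]" by (simp add: of_nat_poly)
    ultimately show ?thesis using prime_dvd_power_diff_self[OF p, of a]
      by (simp add: const_poly_dvd_iff coeff_pCons split: nat.split)
  qed
  moreover have "of_nat p dvd ?X * (P ^ p - pcompose P ?X)" using pCons.IH by (rule dvd_mult)
  ultimately have "of_nat p dvd ((pCons a P) ^ p - [:a:] ^ p - (?x * P) ^ p) + ([:a:] ^ p - [:a:])
      + ?X * (P ^ p - pcompose P ?X)"
    using 1 by (intro dvd_add)
  also have "\<dots> = pCons a P ^ p - pcompose (pCons a P) ?X"
  proof -
    have "(?x * P) ^ p = ?X * P ^ p" by (simp only: X power_mult_distrib)
    then show ?thesis
      by (simp only: pcompose_pCons) (simp only: right_diff_distrib diff_diff_eq2 algebra_simps)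
  qed
  finally show ?case .
qed

lemma frobenius_power_int_poly:
  fixes P :: "int poly"
  assumes p: "prime (p :: nat)"
  shows "of_nat p dvd P ^ (p ^ m) - pcompose P (Polynomial.monom 1 (p ^ m))"
proof (induction m)
  case 0
  then show ?case by (simp add: monom_altdef)
next
  case (Suc m)
  let ?X = "\<lambda>m. Polynomial.monom 1 m :: int poly"
  have "P ^ (p ^ m) - pcompose P (?X (p ^ m)) dvd (P ^ (p ^ m)) ^ p - (pcompose P (?X (p ^ m))) ^ p"
    by (subst power_diff_sumr2) simp
  with Suc have 1: "of_nat p dvd (P ^ (p ^ m)) ^ p - (pcompose P (?X (p ^ m))) ^ p"
    using dvd_trans by blast
  have 2: "of_nat p dvd (pcompose P (?X (p ^ m))) ^ p - pcompose (pcompose P (?X (p ^ m))) (?X p)"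
    by (rule frobenius_int_poly[OF p])
  have "pcompose (pcompose P (?X (p ^ m))) (?X p) = pcompose P (pcompose (?X (p ^ m)) (?X p))"
    by (simp add: pcompose_assoc)
  also have "pcompose (?X (p ^ m)) (?X p) = ?X (p ^ Suc m)"
  proof -
    have "pcompose (?X k) (?X p) = ?X (p * k)" for k
      by (induction k) (simp_all add: monom_0 monom_Suc[of _ "k" for k] pcompose_pCons mult_monom pcompose_1)
    then show ?thesis by simp
  qed
  finally show ?case using dvd_add[OF 1 2] by (simp add: power_mult[symmetric] mult.commute)
qed

section \<open>Roots of unity\<close>

lemma zeta_eq_cis: "zeta m = cis (2 * pi / real m)"
  by (simp add: zeta_def cis_conv_exp mult_ac)

lemma zeta_nonzero [simp]: "zeta m \<noteq> 0"
  by (simp add: zeta_def)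

lemma norm_zeta [simp]: "norm (zeta m) = 1"
  by (simp add: zeta_eq_cis)

lemma zeta_power_self [simp]: "m > 0 \<Longrightarrow> zeta m ^ m = 1"
  by (simp add: zeta_eq_cis DeMoivre)

lemma zeta_mult_power: "d > 0 \<Longrightarrow> zeta (m * d) ^ d = zeta m"
  by (simp add: zeta_eq_cis DeMoivre field_simps)

lemma zeta_power_mod: "m > 0 \<Longrightarrow> zeta m ^ (j mod m) = zeta m ^ j"
  by (metis mod_mult_div_eq mult_1_right power_add power_mult power_one zeta_power_self)

lemma zeta_powers_inj: "m > 0 \<Longrightarrow> inj_on (\<lambda>j. zeta m ^ j) {..<m}"
proof -
  assume "m > 0"
  then have "inj_on (\<lambda>k. cis (2 * pi * real k / real m)) {..<m}"
    using bij_betw_roots_unity by (auto simp: bij_betw_def)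
  then show ?thesis
    by (simp add: zeta_eq_cis DeMoivre mult_ac)
qed

lemma zeta_power_eq_1_iff: "m > 0 \<Longrightarrow> zeta m ^ j = 1 \<longleftrightarrow> m dvd j"
proof
  assume m: "m > 0" and "zeta m ^ j = 1"
  then have "zeta m ^ (j mod m) = zeta m ^ 0" by (simp add: zeta_power_mod)
  then have "j mod m = 0"
    using inj_onD[OF zeta_powers_inj[OF m], of "j mod m" 0] m by auto
  then show "m dvd j" by (simp add: mod_eq_0_iff_dvd)
qed (auto elim!: dvdE simp: power_mult)

lemma root_of_unity_is_zeta_power:
  assumes "m > 0" and "w ^ m = 1"
  shows "\<exists>j<m. w = zeta m ^ j"
proof -
  have "w \<in> (\<lambda>k. cis (2 * pi * real k / real m)) ` {..<m}"
    using bij_betw_roots_unity[OF assms(1)] assms(2) by (auto simp: bij_betw_def)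
  then show ?thesis
    by (auto simp: zeta_eq_cis DeMoivre mult_ac)
qed

lemma power_sum_root_of_unity:
  fixes w :: complex
  assumes "w ^ m = 1"
  shows "(\<Sum>j<m. w ^ j) = (if w = 1 then of_nat m else 0)"
  using assms geometric_sum[of w m] by simp

section \<open>Eisenstein's criterion\<close>

text \<open>If \<open>p\<close> divides all non-leading coefficients of \<open>A * B\<close> but not the constant term of \<open>A\<close>, then the
  first coefficient of \<open>B\<close> prime to \<open>p\<close>, at index \<open>t\<close> say, makes the coefficient of \<open>A * B\<close> at \<open>t\<close> prime
  to \<open>p\<close>.  Hence \<open>t\<close> is the full degree of \<open>A * B\<close> and nothing is left for \<open>A\<close>.\<close>
lemma eisenstein_aux:
  fixes A B :: "int poly" and p :: int
  assumes p: "prime p" and "lead_coeff (A * B) = 1"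
    and dvd: "\<And>i. i < degree (A * B) \<Longrightarrow> p dvd poly.coeff (A * B) i"
    and A: "\<not> p dvd poly.coeff A 0"
  shows "degree A = 0"
proof -
  have nz: "A \<noteq> 0" "B \<noteq> 0" using assms(2) by auto
  have lB: "\<not> p dvd lead_coeff B"
  proof
    assume "p dvd lead_coeff B"
    then have "p dvd lead_coeff (A * B)" by (simp add: lead_coeff_mult)
    with assms(2) p show False using not_prime_unit by auto
  qed
  define t where "t = (LEAST i. \<not> p dvd poly.coeff B i)"
  have t: "\<not> p dvd poly.coeff B t"
    unfolding t_def using lB by (rule LeastI)
  have tmin: "p dvd poly.coeff B i" if "i < t" for i
    using not_less_Least that unfolding t_def by blast
  have "poly.coeff (A * B) t = (\<Sum>i\<le>t. poly.coeff A i * poly.coeff B (t - i))"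
    by (simp add: coeff_mult)
  also have "\<dots> = poly.coeff A 0 * poly.coeff B t
      + (\<Sum>i\<in>{..t} - {0}. poly.coeff A i * poly.coeff B (t - i))"
    by (subst sum.remove[of _ 0]) auto
  finally have eq: "poly.coeff (A * B) t = \<dots>" .
  have "p dvd (\<Sum>i\<in>{..t} - {0}. poly.coeff A i * poly.coeff B (t - i))"
    by (rule dvd_sum) (auto intro!: dvd_mult tmin)
  moreover have "\<not> p dvd poly.coeff A 0 * poly.coeff B t"
    using A t p by (simp add: prime_dvd_mult_iff)
  ultimately have "\<not> p dvd poly.coeff (A * B) t"
    unfolding eq by (simp add: dvd_add_left_iff)
  then have "t \<ge> degree (A * B)" using dvd[of t] by linarith
  moreover have "t \<le> degree B"
    using t by (metis dvd_0_right le_degree)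
  ultimately show ?thesis using nz by (simp add: degree_mult_eq)
qed

text \<open>As \<open>p^2\<close> does not divide the constant term of the product, one of the two factors has a constant
  term prime to \<open>p\<close>.\<close>
lemma eisenstein:
  fixes A B :: "int poly" and p :: int
  assumes p: "prime p" and "lead_coeff (A * B) = 1"
    and "\<And>i. i < degree (A * B) \<Longrightarrow> p dvd poly.coeff (A * B) i"
    and "\<not> p ^ 2 dvd poly.coeff (A * B) 0"
  shows "degree A = 0 \<or> degree B = 0"
proof -
  have "\<not> p dvd poly.coeff A 0 \<or> \<not> p dvd poly.coeff B 0"
    using assms(4) mult_dvd_mono[of p "poly.coeff A 0" p "poly.coeff B 0"]
    by (auto simp: coeff_mult power2_eq_square)
  then show ?thesis
    using eisenstein_aux[of p A B] eisenstein_aux[of p B A] assms by (auto simp: mult.commute)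
qed

section \<open>The cyclotomic polynomial of prime power order\<close>

locale odd_prime_power =
  fixes p k :: nat
  assumes prime_p: "prime p" and odd_p: "odd p" and k_pos: "k \<ge> 1"
begin

definition q :: nat where "q = p ^ (k - 1)"
definition N :: nat where "N = p ^ k"
definition \<zeta> :: complex where "\<zeta> = zeta N"

text \<open>Euler's totient of \<open>N\<close>.\<close>
definition \<phi> :: nat where "\<phi> = (p - 1) * q"

text \<open>The \<open>N\<close>-th cyclotomic polynomial, as the quotient of \<open>x^N - 1\<close> by \<open>x^q - 1\<close>.\<close>
definition cyclotomic :: "int poly" where "cyclotomic = (\<Sum>i<p. Polynomial.monom 1 (i * q))"

lemma p_gt_2: "p > 2"
  using prime_p odd_p prime_ge_2_nat[of p] by (cases "p = 2") auto

lemma q_pos [simp]: "q > 0" and N_pos [simp]: "N > 0"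
  using p_gt_2 by (simp_all add: q_def N_def)

lemma N_eq: "N = p * q"
  using k_pos by (simp add: N_def q_def power_eq_if)

lemma N_phi: "N = q + \<phi>"
  using p_gt_2 by (simp add: N_eq \<phi>_def algebra_simps)

lemma odd_N: "odd N"
  using odd_p by (simp add: N_def)

lemma phi_pos [simp]: "\<phi> > 0"
  using p_gt_2 by (simp add: \<phi>_def)

lemma norm_root [simp]: "norm \<zeta> = 1" and root_power_N [simp]: "\<zeta> ^ N = 1"
  by (simp_all add: \<zeta>_def)

lemma root_power_q: "\<zeta> ^ q = zeta p"
  by (simp add: \<zeta>_def N_eq zeta_mult_power)

lemma root_power_eq_1_iff: "\<zeta> ^ j = 1 \<longleftrightarrow> N dvd j"
  by (simp add: \<zeta>_def zeta_power_eq_1_iff)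

lemma cyclotomic_mult: "cyclotomic * (Polynomial.monom 1 q - 1) = Polynomial.monom 1 N - 1"
proof -
  have "cyclotomic = (\<Sum>i<p. Polynomial.monom 1 q ^ i)"
    by (simp add: cyclotomic_def monom_power mult.commute)
  then show ?thesis
    using power_diff_1_eq[of "Polynomial.monom 1 q :: int poly" p]
    by (simp add: monom_power N_eq mult.commute)
qed

lemma coeff_cyclotomic: "poly.coeff cyclotomic m = (\<Sum>i<p. if i * q = m then 1 else 0)"
  by (simp add: cyclotomic_def coeff_sum)

lemma degree_cyclotomic: "degree cyclotomic = \<phi>" and lead_coeff_cyclotomic: "lead_coeff cyclotomic = 1"
proof -
  have "poly.coeff cyclotomic \<phi> = (\<Sum>i\<in>{p - 1}. 1)"
    unfolding coeff_cyclotomic \<phi>_def using p_gt_2 q_pos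
    by (intro sum.mono_neutral_cong_right) (auto simp del: q_pos)
  then have c: "poly.coeff cyclotomic \<phi> = 1" by simp
  show d: "degree cyclotomic = \<phi>"
  proof (rule antisym)
    show "degree cyclotomic \<le> \<phi>"
    proof (rule degree_le, intro allI impI)
      fix m assume m: "m > \<phi>"
      have "i * q \<noteq> m" if "i < p" for i
        using that m mult_le_mono1[of i "p - 1" q] by (auto simp: \<phi>_def)
      then show "poly.coeff cyclotomic m = 0" by (simp add: coeff_cyclotomic)
    qed
    show "\<phi> \<le> degree cyclotomic" using c by (intro le_degree) simp
  qed
  show "lead_coeff cyclotomic = 1" using c d by simp
qed

lemma poly_cyclotomic_1: "poly cyclotomic 1 = int p"
  by (simp add: cyclotomic_def poly_sum poly_monom)

lemma ev_cyclotomic_conjugate: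
  assumes "\<not> p dvd j"
  shows "ev cyclotomic (\<zeta> ^ j) = 0"
proof -
  have "ev cyclotomic (\<zeta> ^ j) * ((\<zeta> ^ j) ^ q - 1) = (\<zeta> ^ j) ^ N - 1"
    using arg_cong[OF cyclotomic_mult, of "\<lambda>P. ev P (\<zeta> ^ j)"] by simp
  also have "\<dots> = 0" by (metis diff_self power_commutes power_mult power_one root_power_N mult.commute)
  finally have "ev cyclotomic (\<zeta> ^ j) = 0 \<or> \<zeta> ^ (j * q) = 1" by (simp add: power_mult)
  moreover have "\<not> N dvd j * q" using assms by (simp add: N_eq)
  ultimately show ?thesis by (simp add: root_power_eq_1_iff)
qed

lemma ev_cyclotomic: "ev cyclotomic \<zeta> = 0"
  using ev_cyclotomic_conjugate[of 1] p_gt_2 by simp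

lemma prime_elem_p: "prime_elem (of_nat p :: int poly)"
  using prime_p by (simp add: of_nat_poly prime_elem_const_poly_iff)

lemma of_nat_p_dvd_imp_dvd_coeff: "of_nat p dvd (P :: int poly) \<Longrightarrow> int p dvd poly.coeff P i"
  by (simp add: of_nat_poly const_poly_dvd_iff)

text \<open>Total ramification of \<open>p\<close>: modulo \<open>p\<close>, \<open>x^q - 1\<close> and \<open>x^N - 1\<close> are powers of \<open>x - 1\<close>, hence so is
  their quotient.\<close>
lemma cyclotomic_congruent: "of_nat p dvd cyclotomic - [:-1, 1:] ^ \<phi>"
proof -
  let ?y = "[:-1, 1:] :: int poly"
  have y: "pcompose ?y (Polynomial.monom 1 m) = Polynomial.monom 1 m - 1" for m
    by (simp add: pcompose_pCons one_pCons)
  have 1: "of_nat p dvd ?y ^ q - (Polynomial.monom 1 q - 1)"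
    using frobenius_power_int_poly[OF prime_p, of ?y "k - 1"] by (simp only: y q_def)
  have 2: "of_nat p dvd ?y ^ N - (Polynomial.monom 1 N - 1)"
    using frobenius_power_int_poly[OF prime_p, of ?y k] by (simp only: y N_def)
  have "?y ^ q * (cyclotomic - ?y ^ \<phi>) =
      cyclotomic * (?y ^ q - (Polynomial.monom 1 q - 1)) - (?y ^ N - (Polynomial.monom 1 N - 1))"
  proof -
    have "?y ^ N = ?y ^ q * ?y ^ \<phi>" by (simp only: N_phi power_add)
    then show ?thesis
      unfolding cyclotomic_mult[symmetric] by (simp only: algebra_simps mult_1_left mult_1_right)
  qed
  then have "of_nat p dvd ?y ^ q * (cyclotomic - ?y ^ \<phi>)"
    using 1 2 by (metis dvd_diff dvd_mult)
  then have "of_nat p dvd ?y ^ q \<or> of_nat p dvd cyclotomic - ?y ^ \<phi>"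
    using prime_elem_p by (simp add: prime_elem_dvd_mult_iff)
  moreover have "\<not> of_nat p dvd ?y ^ q"
  proof
    assume "of_nat p dvd ?y ^ q"
    then have "of_nat p dvd ?y" using prime_elem_p prime_elem_dvd_power by blast
    from of_nat_p_dvd_imp_dvd_coeff[OF this, of 1] show False using p_gt_2 by simp
  qed
  ultimately show ?thesis by blast
qed

text \<open>After the substitution \<open>x \<mapsto> x + 1\<close> the congruence with \<open>(x - 1)^\<phi>\<close> turns into the divisibility of the
  non-leading coefficients required by Eisenstein's criterion, and the constant term becomes the value
  \<open>p\<close> at 1.\<close>
lemma cyclotomic_factors:
  assumes AB: "cyclotomic = A * B"
  shows "degree A = 0 \<or> degree B = 0"
proof -
  let ?s = "[:1, 1:] :: int poly"
  have AB': "pcompose A ?s * pcompose B ?s = pcompose cyclotomic ?s"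
    by (simp add: AB pcompose_mult)
  have deg: "degree (pcompose P ?s) = degree P" for P :: "int poly"
    by (simp add: degree_pcompose)
  have lead: "lead_coeff (pcompose cyclotomic ?s) = 1"
    using lead_coeff_comp[of ?s cyclotomic] lead_coeff_cyclotomic by simp
  have "degree (pcompose A ?s) = 0 \<or> degree (pcompose B ?s) = 0"
  proof (rule eisenstein[of "int p"])
    show "prime (int p)" using prime_p by simp
    show "lead_coeff (pcompose A ?s * pcompose B ?s) = 1"
      using lead by (simp only: AB')
    show "int p dvd poly.coeff (pcompose A ?s * pcompose B ?s) i"
      if "i < degree (pcompose A ?s * pcompose B ?s)" for i
    proof -
      have i: "i < \<phi>" using that by (simp only: AB' deg degree_cyclotomic)
      obtain E where E: "cyclotomic - [:-1, 1:] ^ \<phi> = of_nat p * E"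
        using cyclotomic_congruent by (elim dvdE)
      have "pcompose (cyclotomic - [:-1, 1:] ^ \<phi>) ?s = pcompose cyclotomic ?s - Polynomial.monom 1 \<phi>"
      proof -
        have "pcompose [:-1, 1:] ?s = [:0, 1:]" by (simp add: pcompose_pCons)
        then have "pcompose ([:-1, 1:] ^ m) ?s = [:0, 1:] ^ m" for m
          by (induction m) (simp_all add: pcompose_mult pcompose_1 del: mult_pCons_left)
        then show ?thesis by (simp add: pcompose_diff monom_altdef)
      qed
      moreover have "pcompose (of_nat p * E) ?s = of_nat p * pcompose E ?s"
        by (simp add: pcompose_mult of_nat_poly pcompose_smult)
      ultimately have "of_nat p dvd pcompose cyclotomic ?s - Polynomial.monom 1 \<phi>"
        using E by (metis dvd_triv_left)
      from of_nat_p_dvd_imp_dvd_coeff[OF this, of i] show ?thesis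
        using i by (simp add: AB')
    qed
    have "poly.coeff (pcompose cyclotomic ?s) 0 = int p"
      using poly_cyclotomic_1 by (simp flip: poly_0_coeff_0 add: poly_pcompose)
    then show "\<not> (int p)\<^sup>2 dvd poly.coeff (pcompose A ?s * pcompose B ?s) 0"
      using p_gt_2 by (simp add: AB' power2_eq_square)
  qed
  then show ?thesis by (simp only: deg)
qed

text \<open>An annihilating polynomial \<open>M\<close> of least degree may be taken primitive.  Pseudo-division of the
  cyclotomic polynomial by \<open>M\<close> leaves no remainder, and by Gauss's lemma the constant factor that it
  introduces cancels, so that \<open>M\<close> divides the cyclotomic polynomial over the integers.  By
  irreducibility one of the two factors is constant, and it cannot be \<open>M\<close>, which vanishes at \<open>\<zeta>\<close>.\<close>
lemma cyclotomic_minimal: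
  assumes "P \<noteq> 0" and "ev P \<zeta> = 0"
  shows "degree P \<ge> \<phi>"
proof -
  define S where "S = {P. P \<noteq> 0 \<and> ev P \<zeta> = 0}"
  define M where "M = primitive_part (arg_min degree (\<lambda>P. P \<in> S))"
  have ex: "P \<in> S" using assms by (simp add: S_def)
  define M0 where "M0 = arg_min degree (\<lambda>P. P \<in> S)"
  have M0: "M0 \<in> S" unfolding M0_def using ex by (rule arg_min_natI)
  have M0_min: "degree M0 \<le> degree Q" if "Q \<in> S" for Q
    unfolding M0_def using that by (rule arg_min_nat_le)
  have "ev (smult (content M0) (primitive_part M0)) \<zeta> = 0"
    using M0 by (simp add: S_def)
  then have M: "M \<in> S"
    using M0 by (simp add: S_def M_def M0_def del: content_times_primitive_part)
  have M_min: "degree M \<le> degree Q" if "Q \<in> S" for Q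
    using M0_min[OF that] by (simp add: M_def M0_def)
  have contM: "content M = 1"
    using M by (simp add: M_def S_def)
  obtain Q R where QR: "pseudo_divmod cyclotomic M = (Q, R)" by fastforce
  define c where "c = poly.coeff M (degree M) ^ (Suc (degree cyclotomic) - degree M)"
  have M0': "M \<noteq> 0" using M by (simp add: S_def)
  have c: "c \<noteq> 0" using M0' by (simp add: c_def)
  have div: "smult c cyclotomic = M * Q + R" and R: "R = 0 \<or> degree R < degree M"
    using pseudo_divmod[OF M0' QR] by (simp_all add: c_def)
  have "ev (smult c cyclotomic) \<zeta> = 0"
    by (simp add: ev_cyclotomic)
  then have "ev R \<zeta> = 0" using div M by (simp add: S_def)
  with R M_min have "R = 0" by (force simp: S_def)
  with div have MQ: "smult c cyclotomic = M * Q" by simp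
  have cont_cyclotomic: "content cyclotomic = 1"
    using lead_coeff_cyclotomic content_dvd_coeff[of cyclotomic "degree cyclotomic"]
    by (metis is_unit_normalize normalize_content)
  have "normalize c = content (M * Q)" 
    using arg_cong[OF MQ, of content] cont_cyclotomic by (simp add: content_smult)
  also have "\<dots> = content Q" using contM by (simp add: content_mult)
  finally have "c dvd content Q" by (metis dvd_refl normalize_dvd_iff)
  then have "[:c:] dvd Q" by (simp add: const_poly_dvd_iff_dvd_content)
  then obtain Q' where "Q = [:c:] * Q'" by (elim dvdE)
  then have "smult c cyclotomic = smult c (M * Q')" using MQ by (simp add: mult.commute)
  then have "cyclotomic = M * Q'" using c by (metis smult_cancel)
  then have "degree M = 0 \<or> degree Q' = 0" by (rule cyclotomic_factors)
  moreover have "degree M \<noteq> 0"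
  proof
    assume "degree M = 0"
    then obtain a where "M = [:a:]" by (auto elim: degree_eq_zeroE)
    with M show False by (simp add: S_def)
  qed
  ultimately have "degree Q' = 0" by blast
  then have "degree M = \<phi>"
    using degree_cyclotomic \<open>cyclotomic = M * Q'\<close> M0' by (metis add_0_right degree_mult_eq degree_0 mult_zero_right phi_pos less_irrefl)
  with M_min[OF ex] show ?thesis by simp
qed

text \<open>Division with remainder by the monic cyclotomic polynomial leaves an annihilating polynomial of too
  small a degree.\<close>
lemma cyclotomic_dvd:
  assumes "ev P \<zeta> = 0"
  shows "cyclotomic dvd P"
proof -
  obtain Q R where QR: "pseudo_divmod P cyclotomic = (Q, R)" by fastforce
  have nz: "cyclotomic \<noteq> 0" using lead_coeff_cyclotomic by auto
  have PR: "P = cyclotomic * Q + R" and R: "R = 0 \<or> degree R < \<phi>"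
    using pseudo_divmod[OF nz QR] lead_coeff_cyclotomic degree_cyclotomic by simp_all
  have "ev R \<zeta> = 0" using PR assms ev_cyclotomic by simp
  with R cyclotomic_minimal[of R] have "R = 0" by force
  with PR show ?thesis by simp
qed

text \<open>Evaluation at 1 modulo \<open>p\<close> is well defined on the values at \<open>\<zeta>\<close>: it is the reduction modulo the prime
  \<open>\<zeta> - 1\<close>.\<close>
lemma p_dvd_poly_1:
  assumes "ev P \<zeta> = 0"
  shows "int p dvd poly P 1"
  using cyclotomic_dvd[OF assms] poly_cyclotomic_1 by (auto elim!: dvdE)

text \<open>This makes \<open>P(\<zeta>) \<mapsto> P(\<zeta>^j)\<close> well defined: it is the Galois action on \<open>\<int>[\<zeta>]\<close>.\<close>
lemma ev_conjugate:
  assumes "ev P \<zeta> = 0" and "\<not> p dvd j"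
  shows "ev P (\<zeta> ^ j) = 0"
  using cyclotomic_dvd[OF assms(1)] ev_cyclotomic_conjugate[OF assms(2)] by (auto elim!: dvdE)

section \<open>Complex conjugation and absolute values\<close>

lemma root_conj_power_N: "(\<zeta> ^ j) ^ N = 1"
  by (metis mult.commute power_mult power_one root_power_N)

text \<open>Complex conjugation on \<open>N\<close>-th roots of unity is the power map with exponent \<open>N - 1\<close>, so it lifts to
  integer polynomials.\<close>
definition reflect :: "int poly \<Rightarrow> int poly" where
  "reflect P = pcompose P (Polynomial.monom 1 (N - 1))"

lemma ev_reflect: "ev (reflect P) (\<zeta> ^ j) = cnj (ev P (\<zeta> ^ j))"
proof -
  let ?z = "\<zeta> ^ j"
  have "?z * ?z ^ (N - 1) = 1"
    using root_conj_power_N[of j] N_pos by (metis power_eq_if not_gr_zero)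
  moreover have "?z * cnj ?z = 1"
    using complex_norm_square[of ?z] by (simp add: norm_power)
  moreover have "?z \<noteq> 0" by (simp add: \<zeta>_def)
  ultimately have "?z ^ (N - 1) = cnj ?z" by (metis mult_left_cancel)
  then show ?thesis by (simp add: reflect_def cnj_ev)
qed

lemma poly_reflect_1: "poly (reflect P) 1 = poly P 1"
  by (simp add: reflect_def poly_pcompose poly_monom)

lemma ev_mult_reflect: "ev (P * reflect P) (\<zeta> ^ j) = of_real ((norm (ev P (\<zeta> ^ j)))\<^sup>2)"
  by (simp only: ev_mult ev_reflect complex_norm_square)

text \<open>\<open>|P(\<zeta>)|^2\<close> is itself the value of an integer polynomial, so an integral value is
  preserved by conjugation.\<close>
lemma norm_square_conjugate:
  assumes "(norm (ev P \<zeta>))\<^sup>2 = of_int c" and "\<not> p dvd j"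
  shows "(norm (ev P (\<zeta> ^ j)))\<^sup>2 = of_int c"
proof -
  have "ev (P * reflect P - [:c:]) \<zeta> = 0"
    using ev_mult_reflect[of P 1] assms(1) by simp
  from ev_conjugate[OF this assms(2)]
  have "complex_of_real ((norm (ev P (\<zeta> ^ j)))\<^sup>2) = of_real (of_int c)"
    using ev_mult_reflect[of P j] by simp
  then show ?thesis by (simp only: of_real_eq_iff)
qed

text \<open>Complex conjugation acts trivially on the residue field, so an integral value of \<open>|P(\<zeta>)|^2\<close> reduces to
  the square of the residue of \<open>P(\<zeta>)\<close>.\<close>
lemma norm_square_residue:
  assumes "(norm (ev P \<zeta>))\<^sup>2 = of_int c"
  shows "int p dvd (poly P 1)\<^sup>2 - c"
proof -
  have "ev (P * reflect P - [:c:]) \<zeta> = 0"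
    using ev_mult_reflect[of P 1] assms(1) by simp
  from p_dvd_poly_1[OF this] show ?thesis
    by (simp add: poly_reflect_1 power2_eq_square)
qed

section \<open>Divisibility by powers of the ramified prime\<close>

text \<open>Total ramification at \<open>\<zeta>\<close>: \<open>(\<zeta> - 1)^\<phi>\<close> is \<open>p\<close> times a number \<open>-E(\<zeta>)\<close> that is prime to \<open>\<zeta> - 1\<close>, since it
  reduces to \<open>-1\<close>.\<close>
lemma uniformizer_power:
  obtains E where "poly E 1 = 1" and "(\<zeta> - 1) ^ \<phi> = - of_nat p * ev E \<zeta>"
proof -
  obtain E where E: "cyclotomic - [:-1, 1:] ^ \<phi> = of_nat p * E"
    using cyclotomic_congruent by (elim dvdE)
  have "int p * poly E 1 = int p"
    using arg_cong[OF E, of "\<lambda>P. poly P 1"] by (simp add: poly_cyclotomic_1 of_nat_poly zero_power)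
  then have "poly E 1 = 1" using p_gt_2 by simp
  moreover have "(\<zeta> - 1) ^ \<phi> = - of_nat p * ev E \<zeta>"
    using arg_cong[OF E, of "\<lambda>P. ev P \<zeta>"] by (simp add: ev_cyclotomic minus_equation_iff eq_neg_iff_add_eq_0 add.commute)
  ultimately show ?thesis by (rule that)
qed

text \<open>The kernel of the reduction is generated by \<open>\<zeta> - 1\<close>: divide by \<open>x - 1\<close> with remainder, and note that
  \<open>p\<close> itself is a multiple of \<open>\<zeta> - 1\<close>, as the cyclotomic polynomial takes the value \<open>p\<close> at 1.\<close>
lemma uniformizer_dvd:
  assumes "int p dvd poly R 1"
  obtains R' where "ev R \<zeta> = (\<zeta> - 1) * ev R' \<zeta>"
proof -
  have dec: "\<exists>P'. P = [:-1, 1:] * P' + [:poly P 1:]" for P :: "int poly"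
  proof -
    have "poly (P - [:poly P 1:]) 1 = 0" by simp
    then have "[:-1, 1:] dvd P - [:poly P 1:]" by (simp only: poly_eq_0_iff_dvd)
    then show ?thesis by (metis diff_add_cancel dvdE)
  qed
  have ev_dec: "ev ([:-1, 1:] * P' + [:a:]) \<zeta> = (\<zeta> - 1) * ev P' \<zeta> + of_int a" for P' a
    unfolding ev_add ev_mult by simp
  obtain R1 where "R = [:-1, 1:] * R1 + [:poly R 1:]" using dec by blast
  then have R1: "ev R \<zeta> = (\<zeta> - 1) * ev R1 \<zeta> + of_int (poly R 1)"
    using ev_dec by metis
  obtain C where "cyclotomic = [:-1, 1:] * C + [:poly cyclotomic 1:]" using dec by blast
  then have "ev cyclotomic \<zeta> = (\<zeta> - 1) * ev C \<zeta> + of_int (poly cyclotomic 1)"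
    using ev_dec by metis
  then have C: "of_nat p = - (\<zeta> - 1) * ev C \<zeta>"
    by (simp add: ev_cyclotomic poly_cyclotomic_1) (simp add: algebra_simps eq_neg_iff_add_eq_0)
  obtain d where "poly R 1 = int p * d" using assms by (elim dvdE)
  then have "ev R \<zeta> = (\<zeta> - 1) * ev (R1 - smult d C) \<zeta>"
    using R1 C by (simp add: algebra_simps)
  then show ?thesis by (rule that)
qed

lemma root_neq_1: "\<zeta> \<noteq> 1"
  using root_power_eq_1_iff[of 1] p_gt_2 N_eq by auto

text \<open>The factors \<open>\<zeta> - 1\<close> are split off one at a time.  While fewer than \<open>\<phi> m\<close> of them have been removed,
  the squared absolute value of the cofactor, multiplied by a number prime to \<open>\<zeta> - 1\<close>, is still a
  positive power of \<open>|\<zeta> - 1|^2\<close>; so the cofactor reduces to zero and is divisible once more.\<close>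
lemma norm_square_p_power_imp_dvd:
  assumes Q: "(norm (ev Q \<zeta>))\<^sup>2 = real p ^ (2 * m)"
  obtains B where "ev Q \<zeta> = of_nat p ^ m * ev B \<zeta>"
proof -
  define l where "l = \<zeta> - 1"
  have l: "l \<noteq> 0" using root_neq_1 by (simp add: l_def)
  obtain E where E1: "poly E 1 = 1" and E: "l ^ \<phi> = - of_nat p * ev E \<zeta>"
    unfolding l_def by (rule uniformizer_power)
  have "\<exists>R. ev Q \<zeta> = l ^ s * ev R \<zeta>" if "s \<le> \<phi> * m" for s
    using that
  proof (induction s)
    case 0
    then show ?case by (intro exI[of _ Q]) simp
  next
    case (Suc s)
    then obtain R where R: "ev Q \<zeta> = l ^ s * ev R \<zeta>" by auto
    define t where "t = \<phi> * m - s"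
    have t: "t > 0" "\<phi> * m = s + t" using Suc.prems by (simp_all add: t_def)
    let ?y = "[:-1, 1:] :: int poly"
    have y: "ev ?y \<zeta> = l" by (simp add: l_def)
    \<comment> \<open>Multiplication by a power of \<open>E(\<zeta>)\<close> turns the power of \<open>p\<close> into a power of \<open>l\<close>, and the common
      power of \<open>l\<close> cancels.\<close>
    have "(norm l) ^ (2 * s) * (norm (ev R \<zeta>))\<^sup>2 * norm (ev E \<zeta>) ^ (2 * m)
       = real p ^ (2 * m) * norm (ev E \<zeta>) ^ (2 * m)"
      using Q by (simp add: R norm_mult norm_power power_mult_distrib power_mult[symmetric] mult.commute)
    also have "\<dots> = norm (l ^ \<phi>) ^ (2 * m)"
      by (simp add: E norm_mult power_mult_distrib)
    also have "\<dots> = norm l ^ (2 * s) * norm l ^ (2 * t)"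
    proof -
      have "\<phi> * (2 * m) = 2 * s + 2 * t" using t(2) by (simp add: mult.left_commute)
      then show ?thesis by (metis norm_power power_add power_mult)
    qed
    finally have "(norm (ev R \<zeta>))\<^sup>2 * norm (ev E \<zeta>) ^ (2 * m) = norm l ^ (2 * t)"
      using l by simp
    then have "(norm (ev R \<zeta> * ev E \<zeta> ^ m))\<^sup>2 = (norm (l ^ t))\<^sup>2"
      by (simp add: norm_mult norm_power power_mult_distrib power_mult[symmetric] mult.commute)
    then have "ev (R * E ^ m * reflect (R * E ^ m) - ?y ^ t * reflect (?y ^ t)) (\<zeta> ^ 1) = 0"
      unfolding ev_diff ev_mult_reflect by (simp add: l_def)
    then have "int p dvd (poly R 1)\<^sup>2"
      using p_dvd_poly_1[of "R * E ^ m * reflect (R * E ^ m) - ?y ^ t * reflect (?y ^ t)"] t(1)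
      by (simp add: poly_reflect_1 E1 zero_power power2_eq_square)
    then have "int p dvd poly R 1" using prime_p prime_dvd_power by (metis prime_int_iff prime_nat_int_transfer)
    then obtain R' where "ev R \<zeta> = l * ev R' \<zeta>"
      unfolding l_def by (rule uniformizer_dvd)
    then show ?case using R by (intro exI[of _ R']) simp
  qed
  then obtain R where "ev Q \<zeta> = l ^ (\<phi> * m) * ev R \<zeta>" by blast
  also have "\<dots> = of_nat p ^ m * ev ((- E) ^ m * R) \<zeta>"
    by (simp add: power_mult E power_mult_distrib[symmetric])
  finally show ?thesis by (rule that)
qed

section \<open>Elements with all conjugates of absolute value one\<close>

text \<open>The exponents \<open>j\<close> for which \<open>\<zeta>^j\<close> is conjugate to \<open>\<zeta>\<close>.\<close>
definition unit_exps :: "nat set" where "unit_exps = {j. j < N \<and> \<not> p dvd j}"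

lemma sum_unit_exps: "(\<Sum>j\<in>unit_exps. g j) = (\<Sum>j<N. g j) - (\<Sum>j<q. g (p * j))" for g :: "nat \<Rightarrow> 'a :: ab_group_add"
proof -
  have "{..<N} = unit_exps \<union> (\<lambda>j. p * j) ` {..<q}"
    using p_gt_2 by (auto simp: unit_exps_def N_eq elim!: dvdE)
  moreover have "unit_exps \<inter> (\<lambda>j. p * j) ` {..<q} = {}" by (auto simp: unit_exps_def)
  ultimately have "(\<Sum>j<N. g j) = (\<Sum>j\<in>unit_exps. g j) + (\<Sum>j\<in>(\<lambda>j. p * j) ` {..<q}. g j)"
    by (metis finite_Un finite_lessThan sum.union_disjoint)
  also have "(\<Sum>j\<in>(\<lambda>j. p * j) ` {..<q}. g j) = (\<Sum>j<q. g (p * j))"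
    using p_gt_2 by (subst sum.reindex) (auto simp: inj_on_def)
  finally show ?thesis by simp
qed

lemma card_unit_exps: "card unit_exps = \<phi>"
  using sum_unit_exps[of "\<lambda>_. 1 :: int"] N_phi by simp

text \<open>The trace from \<open>\<int>[\<zeta>]\<close> to \<open>\<int>\<close> takes only multiples of \<open>q\<close> as values; on a power of \<open>\<zeta>\<close> it is the
  difference of two complete sums over roots of unity, of orders dividing \<open>N\<close> and \<open>q\<close>.\<close>
lemma trace_power: "\<exists>c. (\<Sum>j\<in>unit_exps. (\<zeta> ^ j) ^ i) = of_int (int q * c)"
proof -
  define w where "w = \<zeta> ^ i"
  have wN: "w ^ N = 1" by (simp add: w_def root_conj_power_N)
  have "(\<Sum>j\<in>unit_exps. (\<zeta> ^ j) ^ i) = (\<Sum>j\<in>unit_exps. w ^ j)"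
    by (simp add: w_def power_mult[symmetric] mult.commute)
  also have "\<dots> = (\<Sum>j<N. w ^ j) - (\<Sum>j<q. (w ^ p) ^ j)"
    by (simp add: sum_unit_exps power_mult)
  also have "(\<Sum>j<N. w ^ j) = (if w = 1 then of_nat N else 0)"
    using wN by (rule power_sum_root_of_unity)
  also have "(\<Sum>j<q. (w ^ p) ^ j) = (if w ^ p = 1 then of_nat q else 0)"
    using wN by (intro power_sum_root_of_unity) (simp add: N_eq power_mult)
  also have "(if w = 1 then of_nat N else 0) - (if w ^ p = 1 then of_nat q else 0) =
     complex_of_int (int q * ((if w = 1 then int p else 0) - (if w ^ p = 1 then 1 else 0)))"
    by (auto simp: N_eq algebra_simps)
  finally show ?thesis by blast
qed

lemma trace_int_poly: "\<exists>c. (\<Sum>j\<in>unit_exps. ev T (\<zeta> ^ j)) = of_int (int q * c)"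
proof -
  have "\<exists>c. (\<Sum>j\<in>unit_exps. (\<zeta> ^ j) ^ i * ev T (\<zeta> ^ j)) = of_int (int q * c)" for i
  proof (induction T arbitrary: i)
    case 0
    then show ?case by (intro exI[of _ 0]) simp
  next
    case (pCons a T)
    obtain c where c: "(\<Sum>j\<in>unit_exps. (\<zeta> ^ j) ^ Suc i * ev T (\<zeta> ^ j)) = of_int (int q * c)"
      using pCons.IH by blast
    obtain d where d: "(\<Sum>j\<in>unit_exps. (\<zeta> ^ j) ^ i) = of_int (int q * d)"
      using trace_power by blast
    have "(\<Sum>j\<in>unit_exps. (\<zeta> ^ j) ^ i * ev (pCons a T) (\<zeta> ^ j)) =
        of_int a * (\<Sum>j\<in>unit_exps. (\<zeta> ^ j) ^ i) + (\<Sum>j\<in>unit_exps. (\<zeta> ^ j) ^ Suc i * ev T (\<zeta> ^ j))"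
      by (simp add: sum_distrib_left sum.distrib[symmetric] algebra_simps)
    also have "\<dots> = of_int (int q * (a * d + c))"
      unfolding c d by (simp add: algebra_simps)
    finally show ?case by blast
  qed
  from this[of 0] show ?thesis by simp
qed

text \<open>The trace of \<open>|D(\<zeta>)|^2\<close> is a multiple of \<open>q\<close>, but the bound on the \<open>\<phi> = (p - 1) q\<close> conjugates makes it
  at most \<open>4 (p - 1) q / p^2\<close>.  This is less than \<open>q\<close> because \<open>(p - 2)^2 > 0\<close>.\<close>
lemma small_conjugates_imp_zero:
  assumes small: "\<And>j. j \<in> unit_exps \<Longrightarrow> norm (ev D (\<zeta> ^ j)) \<le> 2 / real p"
  shows "ev D \<zeta> = 0"
proof -
  obtain c where c: "(\<Sum>j\<in>unit_exps. ev (D * reflect D) (\<zeta> ^ j)) = of_int (int q * c)"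
    using trace_int_poly by blast
  have "complex_of_real (\<Sum>j\<in>unit_exps. (norm (ev D (\<zeta> ^ j)))\<^sup>2) = of_real (real_of_int (int q * c))"
    using c by (simp only: ev_mult_reflect) simp
  then have eq: "(\<Sum>j\<in>unit_exps. (norm (ev D (\<zeta> ^ j)))\<^sup>2) = real q * of_int c"
    by (simp only: of_real_eq_iff) simp
  have "(\<Sum>j\<in>unit_exps. (norm (ev D (\<zeta> ^ j)))\<^sup>2) \<le> (\<Sum>j\<in>unit_exps. (2 / real p)\<^sup>2)"
    using small by (intro sum_mono power_mono) auto
  also have "\<dots> = real q * (4 * (real p - 1) / (real p)\<^sup>2)"
    using p_gt_2 by (simp add: card_unit_exps \<phi>_def of_nat_diff power_divide)
  also have "4 * (real p - 1) / (real p)\<^sup>2 < 1"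
  proof -
    have "0 < (real p - 2)\<^sup>2" using p_gt_2 by simp
    then show ?thesis using p_gt_2 by (simp add: power2_eq_square algebra_simps)
  qed
  finally have "real q * of_int c < real q * 1" using eq by simp
  then have "c < 1" by simp
  moreover have "real q * of_int c \<ge> 0" unfolding eq[symmetric] by (intro sum_nonneg) simp
  then have "c \<ge> 0" using q_pos by (simp add: zero_le_mult_iff del: q_pos)
  ultimately have "c = 0" by simp
  have fin: "finite unit_exps" by (simp add: unit_exps_def)
  have "p * 1 \<le> N" unfolding N_eq using q_pos by (intro mult_le_mono2) linarith
  then have "1 \<in> unit_exps" using p_gt_2 by (simp add: unit_exps_def)
  have "(\<Sum>j\<in>unit_exps. (norm (ev D (\<zeta> ^ j)))\<^sup>2) = 0" using eq \<open>c = 0\<close> by simp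
  then have "\<forall>j\<in>unit_exps. (norm (ev D (\<zeta> ^ j)))\<^sup>2 = 0"
    using fin by (subst (asm) sum_nonneg_eq_0_iff) auto
  with \<open>1 \<in> unit_exps\<close> show ?thesis by force
qed

text \<open>By the Frobenius congruence \<open>B(\<zeta>)^N\<close> is congruent modulo \<open>p\<close> to the integer \<open>B(1)\<close>, whose square
  is 1 modulo \<open>p\<close>; hence it is congruent to a sign \<open>s\<close>.  All conjugates of the difference have absolute
  value at most 2, so those of its quotient by \<open>p\<close> are too small for a nonzero element, and
  \<open>B(\<zeta>)^N = s\<close>.  Since \<open>N\<close> is odd, \<open>s B(\<zeta>)\<close> is an \<open>N\<close>-th root of unity.  In contrast to Kronecker's theorem
  on such elements this argument identifies the root of unity as well.\<close>
lemma norm_1_imp_root_of_unity: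
  assumes "norm (ev B \<zeta>) = 1"
  obtains s :: int and e where "s \<in> {1, -1}" and "e < N" and "ev B \<zeta> = of_int s * \<zeta> ^ e"
proof -
  obtain D where D: "B ^ N - pcompose B (Polynomial.monom 1 N) = of_nat p * D"
    using frobenius_power_int_poly[OF prime_p, of B k] unfolding N_def by (elim dvdE)
  have frob: "ev B (\<zeta> ^ j) ^ N = of_int (poly B 1) + of_nat p * ev D (\<zeta> ^ j)" for j
  proof -
    have "ev B (\<zeta> ^ j) ^ N - ev B ((\<zeta> ^ j) ^ N) = of_nat p * ev D (\<zeta> ^ j)"
      using arg_cong[OF D, of "\<lambda>P. ev P (\<zeta> ^ j)"] by simp
    then show ?thesis by (simp only: root_conj_power_N ev_at_1) (simp add: algebra_simps)
  qed
  have "int p dvd (poly B 1)\<^sup>2 - 1"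
    using assms by (intro norm_square_residue) simp
  then have "int p dvd (poly B 1 - 1) * (poly B 1 + 1)"
    by (simp add: power2_eq_square algebra_simps)
  then have "int p dvd poly B 1 - 1 \<or> int p dvd poly B 1 - (-1)"
    using prime_p by (simp add: prime_dvd_mult_iff)
  then obtain s where s: "s \<in> {1, -1}" and "int p dvd poly B 1 - s" by blast
  then obtain d where d: "poly B 1 = s + int p * d" by (metis add.commute diff_add_cancel dvdE)
  have frob': "ev B (\<zeta> ^ j) ^ N - of_int s = of_nat p * ev (D + [:d:]) (\<zeta> ^ j)" for j
    by (simp add: frob d algebra_simps)
  have "ev (D + [:d:]) \<zeta> = 0"
  proof (rule small_conjugates_imp_zero)
    fix j assume "j \<in> unit_exps"
    then have "(norm (ev B (\<zeta> ^ j)))\<^sup>2 = of_int 1"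
      using assms by (intro norm_square_conjugate) (auto simp: unit_exps_def)
    then have 1: "norm (ev B (\<zeta> ^ j)) = 1" by (simp add: power2_eq_1_iff) (smt (verit) norm_ge_zero)
    have "real p * norm (ev (D + [:d:]) (\<zeta> ^ j)) = norm (ev B (\<zeta> ^ j) ^ N - of_int s)"
      unfolding frob' by (simp add: norm_mult)
    also have "\<dots> \<le> norm (ev B (\<zeta> ^ j) ^ N) + norm (complex_of_int s)"
      by (rule norm_triangle_ineq4)
    also have "\<dots> = 2" using s by (auto simp: norm_power 1)
    finally show "norm (ev (D + [:d:]) (\<zeta> ^ j)) \<le> 2 / real p"
      using p_gt_2 by (simp add: field_simps)
  qed
  then have BN: "ev B \<zeta> ^ N = of_int s" using frob'[of 1] by simp
  have "complex_of_int s ^ N = of_int s" using s odd_N by auto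
  then have "(of_int s * ev B \<zeta>) ^ N = of_int s * of_int s"
    by (simp only: power_mult_distrib BN)
  then have "(of_int s * ev B \<zeta>) ^ N = 1"
    using s by auto
  then obtain e where "e < N" and "of_int s * ev B \<zeta> = \<zeta> ^ e"
    using root_of_unity_is_zeta_power[OF N_pos] by (auto simp: \<zeta>_def)
  moreover from this have "ev B \<zeta> = of_int s * \<zeta> ^ e" using s by (metis empty_iff insert_iff minus_mult_minus mult.assoc mult_1_left of_int_1 of_int_minus)
  ultimately show ?thesis using s that by blast
qed

end

section \<open>A square root of plus or minus p\<close>

text \<open>The polynomial \<open>1 + x + \<dots> + x^(m-1)\<close> has the nontrivial \<open>m\<close>-th roots of unity as its roots; compare
  values at 1.\<close>
lemma prod_one_minus_zeta:
  assumes "m > 0"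
  shows "(\<Prod>j\<in>{1..<m}. 1 - zeta m ^ j) = of_nat m"
proof -
  define P where "P = (\<Sum>i<m. Polynomial.monom (1::complex) i)"
  define Q where "Q = (\<Prod>j\<in>{1..<m}. [:- (zeta m ^ j), 1:])"
  define A where "A = (\<lambda>j. zeta m ^ j) ` {1..<m}"
  have cP: "poly.coeff P i = (if i < m then 1 else 0)" for i
    by (simp add: P_def coeff_sum)
  have PA: "poly P z = (\<Sum>i<m. z ^ i)" for z
    by (simp add: P_def poly_sum poly_monom)
  have dQ: "degree Q = m - 1"
    unfolding Q_def by (subst degree_prod_eq_sum_degree) auto
  have "P = Q"
  proof (rule poly_eqI_degree_lead_coeff[where n = "m - 1" and A = A])
    show "poly.coeff P (m - 1) = poly.coeff Q (m - 1)"
    proof -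
      have "lead_coeff Q = 1" unfolding Q_def by (simp add: lead_coeff_prod)
      then show ?thesis using assms by (simp add: cP dQ)
    qed
    show "degree P \<le> m - 1" by (rule degree_le) (auto simp: cP)
    show "degree Q \<le> m - 1" by (simp add: dQ)
    have "card A = card {1..<m}" unfolding A_def
      by (intro card_image inj_on_subset[OF zeta_powers_inj[OF assms]]) auto
    then show "m - 1 \<le> card A" by simp
    fix z assume "z \<in> A"
    then obtain j where j: "j \<in> {1..<m}" "z = zeta m ^ j" by (auto simp: A_def)
    have "z ^ m = 1" using assms
      by (simp add: j(2) flip: power_mult) (metis mult.commute power_mult power_one zeta_power_self)
    moreover have "z \<noteq> 1" using j assms by (auto simp: zeta_power_eq_1_iff dest: dvd_imp_le)
    ultimately have "poly P z = 0" unfolding PA by (simp add: power_sum_root_of_unity)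
    moreover have "poly Q z = 0" using j by (auto simp: Q_def poly_prod)
    ultimately show "poly P z = poly Q z" by simp
  qed
  then have "poly Q 1 = poly P 1" by simp
  then show ?thesis by (simp add: PA) (simp add: Q_def poly_prod)
qed

text \<open>In \<open>p = \<Prod>_j (1 - \<zeta>_p^j)\<close> the factors for \<open>j\<close> and \<open>p - j\<close> agree up to \<open>-\<zeta>_p^(p-j)\<close>.  Hence \<open>p\<close> is,
  up to sign, the square of half of the product times a power of \<open>\<zeta>_p\<close>, and that power is a square
  as well because \<open>p\<close> is odd.\<close>
lemma zeta_quadratic_root:
  assumes p: "odd p"
  obtains G :: "int poly" where "(ev G (zeta p))\<^sup>2 = (- 1) ^ ((p - 1) div 2) * of_nat p"
proof -
  define h where "h = (p - 1) div 2"
  have ph: "p = 2 * h + 1" using p by (auto simp: h_def elim!: oddE)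
  then have p0: "p > 0" by simp
  let ?w = "zeta p"
  define A where "A = (\<Prod>j\<in>{1..h}. 1 - ?w ^ j)"
  define s where "s = (\<Sum>j\<in>{1..h}. p - j)"
  have pair: "1 - ?w ^ (p - j) = - (?w ^ (p - j)) * (1 - ?w ^ j)" if "j \<in> {1..h}" for j
  proof -
    have "?w ^ (p - j) * ?w ^ j = 1"
      using that ph by (simp only: power_add[symmetric]) (simp del: power_Suc)
    then show ?thesis by (simp add: algebra_simps)
  qed
  have "of_nat p = (\<Prod>j\<in>{1..<p}. 1 - ?w ^ j)"
    using prod_one_minus_zeta[OF p0] by simp
  also have "{1..<p} = {1..h} \<union> (\<lambda>j. p - j) ` {1..h}"
  proof -
    have "x \<in> (\<lambda>j. p - j) ` {1..h}" if "x \<in> {h<..<p}" for x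
      using that ph by (intro image_eqI[of _ _ "p - x"]) auto
    moreover have "(\<lambda>j. p - j) ` {1..h} \<subseteq> {1..<p}" using ph by auto
    moreover have "{1..<p} = {1..h} \<union> {h<..<p}" using ph by auto
    ultimately show ?thesis by blast
  qed
  also have "(\<Prod>j\<in>{1..h} \<union> (\<lambda>j. p - j) ` {1..h}. 1 - ?w ^ j) =
      A * (\<Prod>j\<in>(\<lambda>j. p - j) ` {1..h}. 1 - ?w ^ j)"
    unfolding A_def using ph by (intro prod.union_disjoint) auto
  also have "(\<Prod>j\<in>(\<lambda>j. p - j) ` {1..h}. 1 - ?w ^ j) = (\<Prod>j\<in>{1..h}. 1 - ?w ^ (p - j))"
    using ph by (subst prod.reindex) (auto simp: inj_on_def)
  also have "\<dots> = (\<Prod>j\<in>{1..h}. (- 1) * ?w ^ (p - j) * (1 - ?w ^ j))"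
    using pair by (intro prod.cong) auto
  also have "\<dots> = (- 1) ^ h * ?w ^ s * A"
    unfolding prod.distrib A_def s_def power_sum by simp
  finally have eq: "of_nat p = (- 1) ^ h * (?w ^ s * A\<^sup>2)" by (simp add: power2_eq_square mult_ac)
  \<comment> \<open>Since \<open>2 (h + 1) \<equiv> 1\<close> modulo \<open>p\<close>, the exponent \<open>s * (h + 1)\<close> is half of \<open>s\<close>
    modulo \<open>p\<close>.\<close>
  define G where "G = Polynomial.monom 1 (s * (h + 1)) * (\<Prod>j\<in>{1..h}. 1 - Polynomial.monom 1 j :: int poly)"
  have "?w ^ (s * (h + 1) * 2) = ?w ^ s * (?w ^ p) ^ s"
    by (simp only: ph flip: power_mult power_add) (simp add: algebra_simps)
  then have "?w ^ (s * (h + 1) * 2) = ?w ^ s" using p0 by simp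
  moreover have "ev G ?w = ?w ^ (s * (h + 1)) * A" by (simp add: G_def A_def)
  ultimately have "(ev G ?w)\<^sup>2 = ?w ^ s * A\<^sup>2" by (simp only: power_mult_distrib power_mult[symmetric])
  also have "\<dots> = (- 1) ^ h * of_nat p" unfolding eq by (simp flip: mult.assoc power_add mult_2)
  finally show ?thesis using that by (simp add: h_def)
qed

text \<open>The sign \<open>(-1)^((p-1)/2)\<close> is 1 exactly for \<open>p \<equiv> 1\<close> modulo 4.  So \<open>g / \<surd>p\<close> is a sign in this case
  and \<open>\<plusminus>\<i>\<close> otherwise, and only odd powers retain the factor \<open>\<i>\<close>.\<close>
lemma normalized_power_of_quadratic_root:
  fixes g :: complex
  assumes p: "odd p" and g: "g\<^sup>2 = (- 1) ^ ((p - 1) div 2) * of_nat p"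
  obtains s :: int where "s \<in> {1, -1}"
    and "of_real (real p powr (- real n / 2)) * g ^ n =
      (if even n \<or> (odd n \<and> [p = 1] (mod 4)) then of_int s else of_int s * \<i>)"
proof -
  have p0: "p > 0" using p by (auto elim: oddE)
  define t where "t = g / of_real (sqrt (real p))"
  have "(of_real (sqrt (real p)) :: complex)\<^sup>2 = of_nat p"
    by (simp flip: of_real_power)
  then have t2: "t\<^sup>2 = (- 1) ^ ((p - 1) div 2)"
    using p0 g by (simp add: t_def power_divide)
  have "real p powr (- real n / 2) = (1 / sqrt (real p)) ^ n"
  proof -
    have "real p powr (- real n / 2) = (real p powr (- (1 / 2))) powr real n"
      by (simp add: powr_powr)
    also have "real p powr (- (1 / 2)) = 1 / sqrt (real p)"
      using p0 by (simp add: powr_minus_divide powr_half_sqrt)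
    also have "(1 / sqrt (real p)) powr real n = (1 / sqrt (real p)) ^ n"
      using p0 by (simp add: powr_realpow)
    finally show ?thesis .
  qed
  then have eq: "of_real (real p powr (- real n / 2)) * g ^ n = t ^ n"
    by (simp add: t_def power_divide)
  have parity: "even ((p - 1) div 2) \<longleftrightarrow> [p = 1] (mod 4)"
  proof -
    obtain m where m: "p = 2 * m + 1" using p by (elim oddE)
    show ?thesis by (cases "even m") (auto simp: m cong_def elim!: evenE oddE)
  qed
  have even_pow: "\<exists>s\<in>{1, -1::int}. t ^ (2 * l) = of_int s" for l
  proof -
    have "t ^ (2 * l) = ((- 1) ^ ((p - 1) div 2)) ^ l" by (simp only: power_mult t2)
    also have "\<dots> = (- 1) ^ ((p - 1) div 2 * l)" by (simp only: power_mult)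
    finally show ?thesis by (cases "even ((p - 1) div 2 * l)") (simp_all del: even_mult_iff)
  qed
  show ?thesis
  proof (cases "even n")
    case True
    then obtain l where l: "n = 2 * l" by (elim evenE)
    obtain s where s: "s \<in> {1, -1::int}" "t ^ (2 * l) = of_int s" using even_pow by blast
    show ?thesis
    proof (rule that)
      show "s \<in> {1, -1}" by (rule s)
      show "of_real (real p powr (- real n / 2)) * g ^ n =
          (if even n \<or> (odd n \<and> [p = 1] (mod 4)) then of_int s else of_int s * \<i>)"
        unfolding eq using s(2) l by simp
    qed
  next
    case False
    then obtain l where l: "n = 2 * l + 1" by (elim oddE)
    obtain s where s: "s \<in> {1, -1::int}" "t ^ (2 * l) = of_int s" using even_pow by blast
    have tn: "t ^ n = of_int s * t" using s l by simp
    show ?thesis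
    proof (cases "[p = 1] (mod 4)")
      case True
      then have "t\<^sup>2 = 1" using t2 parity by simp
      then have "t = 1 \<or> t = -1" by (simp add: power2_eq_1_iff)
      then show ?thesis using True False s tn eq that[of s] that[of "-s"] by auto
    next
      case no: False
      then have "t\<^sup>2 = \<i>\<^sup>2" using t2 parity by simp
      then have "t = \<i> \<or> t = -\<i>" by (simp only: power2_eq_iff)
      then show ?thesis using no False s tn eq that[of s] that[of "-s"] by auto
    qed
  qed
qed

section \<open>Elements whose squared absolute value is a power of p\<close>

context odd_prime_power
begin

text \<open>Multiplication by the \<open>n\<close>-th power of the conjugate of \<open>G\<close> makes the squared absolute value an even
  power of \<open>p\<close>; the power of \<open>p\<close> that then splits off is the product of this factor with \<open>G^n\<close>.\<close>
lemma norm_square_p_power_classification: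
  assumes G: "(ev G \<zeta>)\<^sup>2 = (- 1) ^ h * of_nat p"
    and P: "(norm (ev P \<zeta>))\<^sup>2 = real p ^ n"
  obtains s :: int and e where "s \<in> {1, -1}" and "e < N" and "ev P \<zeta> = of_int s * ev G \<zeta> ^ n * \<zeta> ^ e"
proof -
  let ?g = "ev G \<zeta>"
  have "norm (?g\<^sup>2) = real p" unfolding G by (simp add: norm_mult norm_power)
  then have g: "(norm ?g)\<^sup>2 = real p" by (simp add: norm_power)
  then have gc: "?g * cnj ?g = of_nat p" by (simp flip: complex_norm_square)
  have g0: "?g \<noteq> 0" using g p_gt_2 by auto
  let ?Q = "P * reflect G ^ n"
  have evQ: "ev ?Q \<zeta> = ev P \<zeta> * cnj ?g ^ n" using ev_reflect[of G 1] by simp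
  have "(norm (ev ?Q \<zeta>))\<^sup>2 = real p ^ (2 * n)"
  proof -
    have "(norm (ev ?Q \<zeta>))\<^sup>2 = (norm (ev P \<zeta>))\<^sup>2 * ((norm ?g)\<^sup>2) ^ n"
      unfolding evQ
      by (simp add: norm_mult norm_power power_mult_distrib power_mult[symmetric] mult.commute[of n 2])
    then show ?thesis by (simp only: P g mult_2 power_add)
  qed
  then obtain B where B: "ev ?Q \<zeta> = of_nat p ^ n * ev B \<zeta>"
    by (rule norm_square_p_power_imp_dvd)
  have "ev P \<zeta> * of_nat p ^ n = ?g ^ n * ev ?Q \<zeta>"
    unfolding evQ gc[symmetric] by (simp add: power_mult_distrib mult_ac)
  then have eq: "ev P \<zeta> = ?g ^ n * ev B \<zeta>"
    unfolding B using p_gt_2 by simp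
  have "real p ^ n = real p ^ n * (norm (ev B \<zeta>))\<^sup>2"
    using P unfolding eq g[symmetric]
    by (simp add: norm_mult norm_power power_mult_distrib power_mult[symmetric] mult.commute[of n 2])
  then have "(norm (ev B \<zeta>))\<^sup>2 = 1" using p_gt_2 by simp
  then have "norm (ev B \<zeta>) = 1" by (simp add: power2_eq_1_iff) (smt (verit) norm_ge_zero)
  then obtain s e where "s \<in> {1, -1}" "e < N" "ev B \<zeta> = of_int s * \<zeta> ^ e"
    by (rule norm_1_imp_root_of_unity)
  then show ?thesis using eq by (intro that[of s e]) auto
qed

text \<open>The conjugations \<open>\<zeta> \<mapsto> \<zeta>^(1+pt)\<close> fix \<open>\<zeta>_p\<close> and multiply \<open>\<zeta>^e\<close> by \<open>w^(te)\<close>, with \<open>w = \<zeta>^p\<close> of order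
  \<open>q\<close>.  They turn one linear relation into \<open>q\<close> relations, from which a discrete Fourier transform over \<open>t\<close>
  isolates each term.\<close>
lemma independent_over_zeta_p:
  assumes "(\<Sum>e<q. \<zeta> ^ e * ev (D e) (zeta p)) = 0" and "e < q"
  shows "ev (D e) (zeta p) = 0"
proof -
  define w where "w = \<zeta> ^ p"
  have w: "w = zeta q"
    using zeta_mult_power[of p q] p_gt_2 by (simp add: w_def \<zeta>_def N_eq mult.commute)
  define T where "T = (\<Sum>e<q. Polynomial.monom 1 e * pcompose (D e) (Polynomial.monom 1 q))"
  have T: "ev T (\<zeta> ^ (1 + p * t)) = (\<Sum>d<q. w ^ (t * d) * (\<zeta> ^ d * ev (D d) (zeta p)))" for t
  proof -
    have "(\<zeta> ^ (1 + p * t)) ^ q = zeta p * (\<zeta> ^ N) ^ t"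
      unfolding root_power_q[symmetric]
      by (simp only: N_eq power_mult[symmetric] power_add[symmetric] add_mult_distrib mult_1_left mult.assoc mult.commute[of t])
    then have "(\<zeta> ^ (1 + p * t)) ^ q = zeta p" by simp
    moreover have "(\<zeta> ^ (1 + p * t)) ^ d = w ^ (t * d) * \<zeta> ^ d" for d
      by (simp only: w_def power_mult[symmetric] power_add[symmetric] add_mult_distrib mult_1_left mult.assoc add.commute)
    ultimately show ?thesis by (simp add: T_def mult.assoc del: power_Suc power_add)
  qed
  have "ev T \<zeta> = 0" using T[of 0] assms(1) by simp
  then have T0: "ev T (\<zeta> ^ (1 + p * t)) = 0" for t
  proof -
    have "\<not> p dvd 1 + p * t"
    proof
      assume "p dvd 1 + p * t"
      then have "p dvd 1" by (metis dvd_add_left_iff dvd_triv_left)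
      then show False using p_gt_2 by simp
    qed
    with \<open>ev T \<zeta> = 0\<close> show ?thesis by (rule ev_conjugate)
  qed
  \<comment> \<open>\<open>q - e\<close> takes the place of \<open>-e\<close> to keep the exponents natural.\<close>
  have "0 = (\<Sum>t<q. w ^ (t * (q - e)) * ev T (\<zeta> ^ (1 + p * t)))" by (simp only: T0) simp
  also have "\<dots> = (\<Sum>t<q. \<Sum>d<q. (w ^ (q - e + d)) ^ t * (\<zeta> ^ d * ev (D d) (zeta p)))"
    unfolding T sum_distrib_left
  proof (intro sum.cong refl)
    fix t d
    have "w ^ (t * (q - e)) * w ^ (t * d) = (w ^ (q - e + d)) ^ t"
      by (simp only: power_mult[symmetric] power_add[symmetric] add_mult_distrib mult.commute[of t])
    then show "w ^ (t * (q - e)) * (w ^ (t * d) * (\<zeta> ^ d * ev (D d) (zeta p))) =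
        (w ^ (q - e + d)) ^ t * (\<zeta> ^ d * ev (D d) (zeta p))"
      by (simp only: mult.assoc[symmetric])
  qed
  also have "\<dots> = (\<Sum>d<q. (\<Sum>t<q. (w ^ (q - e + d)) ^ t) * (\<zeta> ^ d * ev (D d) (zeta p)))"
    by (subst sum.swap) (simp add: sum_distrib_right)
  also have "\<dots> = (\<Sum>d<q. if d = e then of_nat q * (\<zeta> ^ d * ev (D d) (zeta p)) else 0)"
  proof (intro sum.cong refl)
    fix d assume d: "d \<in> {..<q}"
    have "(w ^ (q - e + d)) ^ q = 1" unfolding w
      by (metis mult.commute power_mult power_one q_pos zeta_power_self)
    moreover have "w ^ (q - e + d) = 1 \<longleftrightarrow> d = e"
    proof -
      have "q dvd q - e + d \<longleftrightarrow> d = e"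
      proof
        assume "q dvd q - e + d"
        then obtain r where r: "q - e + d = q * r" by (elim dvdE)
        have "0 < q * r" "q * r < q * 2"
          unfolding r[symmetric] using d assms(2) by auto
        then have "r = 1" by auto
        with r assms(2) show "d = e" by auto
      qed (use assms(2) in auto)
      then show ?thesis by (simp add: w zeta_power_eq_1_iff)
    qed
    ultimately show "(\<Sum>t<q. (w ^ (q - e + d)) ^ t) * (\<zeta> ^ d * ev (D d) (zeta p)) =
        (if d = e then of_nat q * (\<zeta> ^ d * ev (D d) (zeta p)) else 0)"
      by (simp add: power_sum_root_of_unity)
  qed
  also have "\<dots> = of_nat q * (\<zeta> ^ e * ev (D e) (zeta p))" using assms(2) by simp
  finally show ?thesis using assms(2) by (auto simp: \<zeta>_def)
qed

end

section \<open>Characters of residue vectors\<close>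

lemma zeta_powi_add: "zeta m powi (a + b) = zeta m powi a * zeta m powi b"
  by (simp add: power_int_add)

lemma zeta_powi_eq: "m > 0 \<Longrightarrow> zeta m powi a = zeta m ^ nat (a mod int m)"
proof -
  assume m: "m > 0"
  have "zeta m powi a = zeta m powi (int m * (a div int m) + a mod int m)" by simp
  also have "\<dots> = (zeta m powi int m) powi (a div int m) * zeta m powi (a mod int m)"
    by (simp only: zeta_powi_add power_int_mult)
  also have "zeta m powi int m = 1" using m by simp
  also have "zeta m powi (a mod int m) = zeta m ^ nat (a mod int m)"
    using m by (simp add: power_int_def)
  finally show ?thesis by simp
qed

lemma zeta_powi_cong: "m > 0 \<Longrightarrow> [a = b] (mod int m) \<Longrightarrow> zeta m powi a = zeta m powi b"
  by (simp add: zeta_powi_eq cong_def)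

lemma zeta_powi_mod: "m > 0 \<Longrightarrow> zeta m powi (a mod int m) = zeta m powi a"
  by (rule zeta_powi_cong) auto

lemma zeta_powi_sum: "zeta m powi (\<Sum>i\<in>I. a i) = (\<Prod>i\<in>I. zeta m powi a i)"
  by (induction I rule: infinite_finite_induct) (simp_all add: zeta_powi_add)

lemma norm_zeta_powi [simp]: "norm (zeta m powi a) = 1"
  by (simp add: norm_power_int)

lemma carrier_residue_ring: "carrier (residue_ring m) = {0..m - 1}"
  by (simp add: residue_ring_def)

lemma finite_residue_vecs [simp]: "finite (residue_vecs m d)"
  by (simp add: residue_vecs_def carrier_residue_ring finite_PiE)

lemma sum_zeta_powi_multiples:
  assumes "m > 0"
  shows "(\<Sum>a\<in>{0..int m - 1}. zeta m powi (a * b)) = (if int m dvd b then of_nat m else 0)"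
proof -
  have "{0..int m - 1} = int ` {..<m}" using image_int_atLeastLessThan[of 0 m] by (auto simp: lessThan_atLeast0 zless_nat_eq_int_zless)
  then have "(\<Sum>a\<in>{0..int m - 1}. zeta m powi (a * b)) = (\<Sum>j<m. zeta m powi (int j * b))"
    by (simp add: sum.reindex)
  also have "\<dots> = (\<Sum>j<m. (zeta m powi b) ^ j)"
    by (simp add: mult.commute[of _ b] power_int_mult)
  also have "\<dots> = (if zeta m powi b = 1 then of_nat m else 0)"
  proof (rule power_sum_root_of_unity)
    show "(zeta m powi b) ^ m = 1"
      using assms by (simp add: zeta_powi_eq flip: power_mult) (metis mult.commute power_mult power_one zeta_power_self)
  qed
  also have "zeta m powi b = 1 \<longleftrightarrow> int m dvd b"
  proof -
    have "zeta m powi b = 1 \<longleftrightarrow> m dvd nat (b mod int m)"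
      using assms by (simp add: zeta_powi_eq zeta_power_eq_1_iff)
    also have "\<dots> \<longleftrightarrow> b mod int m = 0"
    proof -
      have "nat (b mod int m) < m" "0 \<le> b mod int m" using assms by (simp_all add: nat_less_iff)
      then have "m dvd nat (b mod int m) \<longleftrightarrow> nat (b mod int m) = 0"
        by (metis dvd_0_right nat_dvd_not_less neq0_conv)
      with \<open>0 \<le> b mod int m\<close> show ?thesis by simp
    qed
    finally show ?thesis by (simp add: dvd_eq_mod_eq_0)
  qed
  finally show ?thesis .
qed

lemma residue_vecs_orthogonality:
  assumes p: "p > 0" and w: "w \<in> residue_vecs p d" and w': "w' \<in> residue_vecs p d"
  shows "(\<Sum>a\<in>residue_vecs p d. zeta p powi (\<Sum>i=1..d. a i * (w i - w' i))) =
    (if w = w' then of_nat p ^ d else 0)"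
proof -
  have "(\<Sum>a\<in>residue_vecs p d. zeta p powi (\<Sum>i=1..d. a i * (w i - w' i))) =
      (\<Prod>i=1..d. \<Sum>a\<in>{0..int p - 1}. zeta p powi (a * (w i - w' i)))"
    unfolding zeta_powi_sum residue_vecs_def carrier_residue_ring by (subst prod_sum_PiE) auto
  also have "\<dots> = (\<Prod>i=1..d. if w i = w' i then of_nat p else 0)"
  proof (intro prod.cong refl)
    fix i assume i: "i \<in> {1..d}"
    have "w i \<in> {0..int p - 1}" "w' i \<in> {0..int p - 1}"
      using i w w' by (auto simp: residue_vecs_def carrier_residue_ring PiE_iff)
    then have "int p dvd w i - w' i \<longleftrightarrow> w i = w' i"
      by (auto simp flip: mod_eq_dvd_iff)
    then show "(\<Sum>a\<in>{0..int p - 1}. zeta p powi (a * (w i - w' i))) = (if w i = w' i then of_nat p else 0)"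
      using p by (simp add: sum_zeta_powi_multiples)
  qed
  also have "\<dots> = (if w = w' then of_nat p ^ d else 0)"
  proof (cases "w = w'")
    case False
    then obtain i where "i \<in> {1..d}" "w i \<noteq> w' i"
      using PiE_ext w w' unfolding residue_vecs_def by blast
    then show ?thesis using False by (auto intro!: prod_zero)
  qed simp
  finally show ?thesis .
qed

text \<open>Fourier inversion in weak form: a weighted family of vectors whose characters sum up like those of the
  weight \<open>K\<close> placed at \<open>v\<close> cannot be distinguished from it by any function \<open>g\<close>.  It suffices to expand
  \<open>g\<close> into characters.\<close>
lemma character_sums_determine:
  fixes c :: "'a \<Rightarrow> complex" and W :: "'a \<Rightarrow> nat \<Rightarrow> int"
  assumes p: "p > 0" and W: "\<And>x. x \<in> X \<Longrightarrow> W x \<in> residue_vecs p d" and v: "v \<in> residue_vecs p d"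
    and eq: "\<And>a. a \<in> residue_vecs p d \<Longrightarrow>
      (\<Sum>x\<in>X. c x * zeta p powi (\<Sum>i=1..d. a i * W x i)) = K * zeta p powi (\<Sum>i=1..d. a i * v i)"
  shows "(\<Sum>x\<in>X. c x * g (W x)) = K * g v"
proof -
  let ?R = "residue_vecs p d"
  define h where "h = (\<lambda>a. \<Sum>w\<in>?R. g w * zeta p powi (- (\<Sum>i=1..d. a i * w i)))"
  have inv: "(\<Sum>a\<in>?R. h a * zeta p powi (\<Sum>i=1..d. a i * w i)) = of_nat p ^ d * g w"
    if w: "w \<in> ?R" for w
  proof -
    have "(\<Sum>a\<in>?R. h a * zeta p powi (\<Sum>i=1..d. a i * w i)) =
        (\<Sum>a\<in>?R. \<Sum>w'\<in>?R. g w' * zeta p powi (\<Sum>i=1..d. a i * (w i - w' i)))"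
      unfolding h_def sum_distrib_right mult.assoc zeta_powi_add[symmetric]
      by (simp add: sum_negf[symmetric] sum.distrib[symmetric] algebra_simps)
    also have "\<dots> = (\<Sum>w'\<in>?R. g w' * (\<Sum>a\<in>?R. zeta p powi (\<Sum>i=1..d. a i * (w i - w' i))))"
      by (subst sum.swap) (simp add: sum_distrib_left)
    also have "\<dots> = (\<Sum>w'\<in>?R. if w' = w then of_nat p ^ d * g w else 0)"
      using residue_vecs_orthogonality[OF p w] by (intro sum.cong) auto
    also have "\<dots> = of_nat p ^ d * g w" using w by simp
    finally show ?thesis .
  qed
  have "of_nat p ^ d * (\<Sum>x\<in>X. c x * g (W x)) = (\<Sum>x\<in>X. c x * (of_nat p ^ d * g (W x)))"
    by (simp add: sum_distrib_left mult_ac)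
  also have "\<dots> = (\<Sum>x\<in>X. c x * (\<Sum>a\<in>?R. h a * zeta p powi (\<Sum>i=1..d. a i * W x i)))"
    using inv[OF W] by simp
  also have "\<dots> = (\<Sum>a\<in>?R. h a * (\<Sum>x\<in>X. c x * zeta p powi (\<Sum>i=1..d. a i * W x i)))"
    unfolding sum_distrib_left by (subst sum.swap) (simp add: mult_ac)
  also have "\<dots> = (\<Sum>a\<in>?R. h a * (K * zeta p powi (\<Sum>i=1..d. a i * v i)))"
    using eq by simp
  also have "\<dots> = K * (\<Sum>a\<in>?R. h a * zeta p powi (\<Sum>i=1..d. a i * v i))"
    by (simp add: sum_distrib_left mult_ac)
  also have "\<dots> = of_nat p ^ d * (K * g v)" unfolding inv[OF v] by (simp only: mult_ac)
  finally show ?thesis using p by simp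
qed

text \<open>The first digit is the most significant one; the induction splits off the last digit.\<close>
lemma base_p_digits:
  fixes w :: "nat \<Rightarrow> nat"
  assumes "\<And>i. i \<in> {1..d} \<Longrightarrow> w i < p"
  shows "(\<Sum>i=1..d. w i * p ^ (d - i)) < p ^ d"
    and "i \<in> {1..d} \<Longrightarrow> (\<Sum>i=1..d. w i * p ^ (d - i)) div p ^ (d - i) mod p = w i"
proof -
  have "(\<Sum>i=1..d. w i * p ^ (d - i)) < p ^ d \<and>
      (\<forall>i\<in>{1..d}. (\<Sum>i=1..d. w i * p ^ (d - i)) div p ^ (d - i) mod p = w i)"
    using assms
  proof (induction d)
    case (Suc d)
    define r where "r = (\<Sum>i=1..d. w i * p ^ (d - i))"
    have IH: "r < p ^ d" "\<And>i. i \<in> {1..d} \<Longrightarrow> r div p ^ (d - i) mod p = w i"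
      using Suc unfolding r_def by auto
    have wp: "w (Suc d) < p" using Suc.prems by simp
    have "(\<Sum>i=1..Suc d. w i * p ^ (Suc d - i)) = (\<Sum>i=1..d. w i * p ^ (Suc d - i)) + w (Suc d)"
      by simp
    also have "(\<Sum>i=1..d. w i * p ^ (Suc d - i)) = p * r"
      unfolding r_def sum_distrib_left by (intro sum.cong) (auto simp: Suc_diff_le)
    finally have r: "(\<Sum>i=1..Suc d. w i * p ^ (Suc d - i)) = p * r + w (Suc d)" .
    have "p * r + w (Suc d) < p * (r + 1)" using wp by simp
    also have "\<dots> \<le> p * p ^ d" using IH(1) by (intro mult_le_mono2) simp
    finally have 1: "p * r + w (Suc d) < p ^ Suc d" by simp
    have 2: "(p * r + w (Suc d)) div p ^ (Suc d - i) mod p = w i" if "i \<in> {1..Suc d}" for i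
    proof (cases "i = Suc d")
      case False
      then have "i \<in> {1..d}" using that by auto
      moreover from this have "(p * r + w (Suc d)) div p ^ (Suc d - i) = r div p ^ (d - i)"
        using wp by (simp add: Suc_diff_le div_mult2_eq)
      ultimately show ?thesis using IH(2) by simp
    qed (use wp in simp)
    show ?case unfolding r using 1 2 by blast
  qed simp
  then show "(\<Sum>i=1..d. w i * p ^ (d - i)) < p ^ d"
    and "i \<in> {1..d} \<Longrightarrow> (\<Sum>i=1..d. w i * p ^ (d - i)) div p ^ (d - i) mod p = w i" by auto
qed

section \<open>Gbent functions\<close>

context odd_prime_power
begin

text \<open>The sums of \<open>\<zeta>_p^(b x)\<close> over the fibres of \<open>r\<close> are the coordinates of the given number in
  the powers \<open>\<zeta>^d\<close> with \<open>d < q\<close>.  The classification of numbers whose squared absolute value is \<open>p^n\<close>,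
  with the exponent of \<open>\<zeta>\<close> written as \<open>j q + e\<close>, shows that only the fibre over \<open>e\<close> has a nonzero
  sum.  Stated with an arbitrary function \<open>\<psi>\<close> of the fibre, this covers all character
  sums at once.\<close>
lemma single_class_of_norm:
  assumes X: "finite X" and r: "\<And>x. x \<in> X \<Longrightarrow> r x < q"
    and norm: "(norm (\<Sum>x\<in>X. zeta p ^ b x * \<zeta> ^ r x))\<^sup>2 = real p ^ n"
    and G: "(ev G (zeta p))\<^sup>2 = (- 1) ^ h * of_nat p"
  obtains s :: int and j e where "s \<in> {1, -1}" and "j < p"
    and "\<forall>\<psi>. (\<Sum>x\<in>X. zeta p ^ b x * \<psi> (r x)) = of_int s * ev G (zeta p) ^ n * zeta p ^ j * \<psi> e"
proof -
  define S where "S = (\<lambda>d. \<Sum>x\<in>{x \<in> X. r x = d}. Polynomial.monom (1::int) (b x))"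
  have group: "(\<Sum>x\<in>X. zeta p ^ b x * \<psi> (r x)) = (\<Sum>d<q. \<psi> d * ev (S d) (zeta p))" for \<psi>
  proof -
    have "(\<Sum>x\<in>X. zeta p ^ b x * \<psi> (r x)) =
        (\<Sum>d<q. \<Sum>x\<in>{x \<in> X. r x = d}. zeta p ^ b x * \<psi> (r x))"
      using X r by (intro sum.group[symmetric]) auto
    also have "\<dots> = (\<Sum>d<q. \<psi> d * ev (S d) (zeta p))"
      unfolding S_def ev_sum sum_distrib_left by (intro sum.cong) auto
    finally show ?thesis .
  qed
  define P where "P = (\<Sum>x\<in>X. Polynomial.monom (1::int) (q * b x + r x))"
  have P: "ev P \<zeta> = (\<Sum>x\<in>X. zeta p ^ b x * \<zeta> ^ r x)"
    by (simp add: P_def power_add power_mult root_power_q)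
  define G' where "G' = pcompose G (Polynomial.monom 1 q)"
  have G': "ev G' \<zeta> = ev G (zeta p)" by (simp add: G'_def root_power_q)
  have "(ev G' \<zeta>)\<^sup>2 = (- 1) ^ h * of_nat p" using G by (simp only: G')
  moreover have "(norm (ev P \<zeta>))\<^sup>2 = real p ^ n" using norm by (simp only: P)
  ultimately obtain s m where s: "s \<in> {1, -1::int}" and m: "m < N"
    and eq: "ev P \<zeta> = of_int s * ev G' \<zeta> ^ n * \<zeta> ^ m"
    by (rule norm_square_p_power_classification)
  define j where "j = m div q"
  define e where "e = m mod q"
  have j: "j < p" using m by (simp add: j_def N_eq less_mult_imp_div_less)
  have e: "e < q" by (simp add: e_def)
  have "\<zeta> ^ m = zeta p ^ j * \<zeta> ^ e"
    unfolding root_power_q[symmetric] power_mult[symmetric] power_add[symmetric] by (simp add: j_def e_def)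
  define C where "C = smult s (G ^ n * Polynomial.monom 1 j)"
  have C: "ev C (zeta p) = of_int s * ev G (zeta p) ^ n * zeta p ^ j" by (simp add: C_def)
  have "(\<Sum>d<q. \<zeta> ^ d * ev (S d - (if d = e then C else 0)) (zeta p)) = 
      (\<Sum>d<q. \<zeta> ^ d * ev (S d) (zeta p)) - (\<Sum>d<q. if d = e then \<zeta> ^ d * ev C (zeta p) else 0)"
    unfolding sum_subtractf[symmetric] by (intro sum.cong) (auto simp: algebra_simps)
  also have "(\<Sum>d<q. \<zeta> ^ d * ev (S d) (zeta p)) = ev P \<zeta>"
    unfolding P using group[of "\<lambda>d. \<zeta> ^ d"] by simp
  also have "(\<Sum>d<q. if d = e then \<zeta> ^ d * ev C (zeta p) else 0) = \<zeta> ^ e * ev C (zeta p)"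
    using e by simp
  also have "ev P \<zeta> - \<zeta> ^ e * ev C (zeta p) = 0"
    unfolding eq C G' \<open>\<zeta> ^ m = _\<close> by simp
  finally have "ev (S d - (if d = e then C else 0)) (zeta p) = 0" if "d < q" for d
    using that by (rule independent_over_zeta_p)
  then have S: "ev (S d) (zeta p) = (if d = e then ev C (zeta p) else 0)" if "d < q" for d
    using that by (force split: if_splits)
  have "(\<Sum>x\<in>X. zeta p ^ b x * \<psi> (r x)) = of_int s * ev G (zeta p) ^ n * zeta p ^ j * \<psi> e" for \<psi>
  proof -
    have "(\<Sum>x\<in>X. zeta p ^ b x * \<psi> (r x)) = (\<Sum>d<q. if d = e then ev C (zeta p) * \<psi> d else 0)"
      unfolding group by (intro sum.cong) (auto simp: S)
    also have "\<dots> = ev C (zeta p) * \<psi> e" using e by simp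
    finally show ?thesis by (simp add: C)
  qed
  then have "\<forall>\<psi>. (\<Sum>x\<in>X. zeta p ^ b x * \<psi> (r x)) = of_int s * ev G (zeta p) ^ n * zeta p ^ j * \<psi> e" by blast
  with s j show ?thesis by (rule that)
qed

end

lemma digits_in_residue_vecs:
  "p > 0 \<Longrightarrow> restrict (\<lambda>i. int (g i mod p)) {1..d} \<in> residue_vecs p d"
proof -
  assume "p > 0"
  then have "int (g i mod p) \<le> int p - 1" for i
    using mod_less_divisor[of p "g i"] by linarith
  then show ?thesis by (simp add: residue_vecs_def carrier_residue_ring)
qed

theorem theorem3p2:
  fixes p n k :: nat
    and F :: "nat \<Rightarrow> (nat \<Rightarrow> int) \<Rightarrow> int"
    and f :: "(nat \<Rightarrow> int) \<Rightarrow> int"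
  assumes "prime p" and "odd p" and "n \<ge> 1" and "k \<ge> 2"
    and "\<And>i. i \<le> k - 1 \<Longrightarrow> F i \<in> residue_vecs p n \<rightarrow> carrier (residue_ring (int p))"
    and "\<And>x. x \<in> residue_vecs p n \<Longrightarrow>
           f x = (\<Sum>i=0..k-1. F i x * int p ^ (k - 1 - i)) mod int (p ^ k)"
  shows "gbent p n (p ^ k) f \<longleftrightarrow>
    (\<forall>u\<in>residue_vecs p n.
      \<exists>v\<in>residue_vecs p (k - 1). \<exists>j\<in>carrier (residue_ring (int p)). \<exists>\<epsilon>\<in>{1, - 1 :: complex}.
        \<forall>a\<in>residue_vecs p (k - 1).
          gwht p n p (\<lambda>x. (F 0 x + (\<Sum>i=1..k-1. a i * F i x)) mod int p) u =
            (if even n \<or> (odd n \<and> [p = 1] (mod 4))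
             then \<epsilon> * zeta p powi (residue_dot p (k - 1) v a + j)
             else \<epsilon> * \<i> * zeta p powi (residue_dot p (k - 1) v a + j)))"
proof -
  interpret odd_prime_power p k using assms by unfold_locales auto
  define d where "d = k - 1"
  define X where "X = residue_vecs p n"
  have finX [simp]: "finite X" by (simp add: X_def)
  have p0: "p > 0" using p_gt_2 by simp
  define c where "c = complex_of_real (real p powr (- real n / 2))"
  have c: "(norm c)\<^sup>2 * real p ^ n = 1"
  proof -
    have "(norm c)\<^sup>2 = real p powr (- real n)"
      using p0 by (simp add: c_def power2_eq_square flip: powr_add)
    then show ?thesis using p0 by (simp add: powr_minus powr_realpow)
  qed
  have c0: "c \<noteq> 0" using c by auto
  define w where "w = (\<lambda>i x. nat (F i x))"
  have F: "F i x = int (w i x)" "w i x < p" if "i \<le> d" "x \<in> X" for i x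
  proof -
    have "F i x \<in> {0..int p - 1}"
      using assms(5)[of i] that by (auto simp: d_def X_def carrier_residue_ring)
    then show "F i x = int (w i x)" "w i x < p" by (auto simp: w_def)
  qed
  \<comment> \<open>All digits of \<open>f x\<close> except the leading one, \<open>F 0 x\<close>; they recover the values \<open>F i x\<close>.\<close>
  define r where "r = (\<lambda>x. \<Sum>i=1..d. w i x * p ^ (d - i))"
  have r: "r x < q" and digit: "i \<in> {1..d} \<Longrightarrow> r x div p ^ (d - i) mod p = w i x" if "x \<in> X" for x i
    using base_p_digits[of d "\<lambda>i. w i x" p] F(2) that by (auto simp: r_def q_def d_def)
  have f: "zeta N powi f x = zeta p powi F 0 x * \<zeta> ^ r x" if x: "x \<in> X" for x
  proof -
    have "(\<Sum>i=0..d. F i x * int p ^ (d - i)) = F 0 x * int q + (\<Sum>i=1..d. F i x * int p ^ (d - i))"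
      by (subst sum.atLeast_Suc_atMost) (simp_all add: q_def d_def)
    also have "(\<Sum>i=1..d. F i x * int p ^ (d - i)) = int (r x)"
      unfolding r_def of_nat_sum using F(1) x by (intro sum.cong) auto
    finally have "f x = (F 0 x * int q + int (r x)) mod int N"
      using assms(6)[of x] x by (simp add: X_def d_def N_def)
    then have "zeta N powi f x = zeta N powi (int q * F 0 x + int (r x))"
      by (simp only: zeta_powi_mod[OF N_pos] mult.commute)
    also have "\<dots> = (\<zeta> ^ q) powi F 0 x * \<zeta> ^ r x"
      by (simp add: zeta_powi_add power_int_mult \<zeta>_def)
    finally show ?thesis by (simp only: root_power_q)
  qed
  \<comment> \<open>The exponent \<open>F 0 x - u\<cdot>x\<close>, reduced to a natural number.\<close>
  define b where "b = (\<lambda>u x. nat ((F 0 x - residue_dot p n u x) mod int p))"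
  have b: "zeta p powi (- residue_dot p n u x) * zeta p powi F 0 x = zeta p ^ b u x" for u x
    unfolding b_def zeta_powi_eq[OF p0, symmetric] zeta_powi_add[symmetric] by (simp add: algebra_simps)
  have H: "gwht p n (p ^ k) f u = c * (\<Sum>x\<in>X. zeta p ^ b u x * \<zeta> ^ r x)" for u
    unfolding gwht_def c_def[symmetric] X_def[symmetric] N_def[symmetric] b[symmetric]
    by (intro arg_cong[where f = "\<lambda>s. c * s"] sum.cong) (simp_all add: f)
  define W where "W = (\<lambda>x. restrict (\<lambda>i. F i x) {1..d})"
  have W: "W x \<in> residue_vecs p d" if "x \<in> X" for x
    using F[OF _ that] by (fastforce simp: W_def residue_vecs_def carrier_residue_ring)
  have Ha: "gwht p n p (\<lambda>x. (F 0 x + (\<Sum>i=1..d. a i * F i x)) mod int p) u =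
      c * (\<Sum>x\<in>X. zeta p ^ b u x * zeta p powi (\<Sum>i=1..d. a i * W x i))" for a u
  proof -
    have "(\<Sum>i=1..d. a i * W x i) = (\<Sum>i=1..d. a i * F i x)" for x
      by (intro sum.cong) (auto simp: W_def)
    then show ?thesis
      unfolding gwht_def c_def[symmetric] X_def[symmetric] b[symmetric]
      by (simp only: zeta_powi_mod[OF p0] zeta_powi_add mult.assoc)
  qed
  have gb: "norm (gwht p n (p ^ k) f u) = 1 \<longleftrightarrow>
      (norm (\<Sum>x\<in>X. zeta p ^ b u x * \<zeta> ^ r x))\<^sup>2 = real p ^ n" for u
  proof -
    define S where "S = norm (\<Sum>x\<in>X. zeta p ^ b u x * \<zeta> ^ r x)"
    have S: "norm (gwht p n (p ^ k) f u) = norm c * S" by (simp add: H S_def norm_mult)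
    have "norm c * S \<ge> 0" by (simp add: S_def)
    then have "norm c * S = 1 \<longleftrightarrow> (norm c * S)\<^sup>2 = 1"
      by (auto simp: power2_eq_1_iff simp del: mult_eq_1_iff)
    also have "\<dots> \<longleftrightarrow> (norm c)\<^sup>2 * S\<^sup>2 = (norm c)\<^sup>2 * real p ^ n"
      by (simp only: power_mult_distrib c)
    also have "\<dots> \<longleftrightarrow> S\<^sup>2 = real p ^ n" using c0 by simp
    finally show ?thesis unfolding S by (simp only: S_def)
  qed
  \<comment> \<open>With \<open>\<kappa>\<close> the two cases of the conclusion become one formula.\<close>
  define \<kappa> where "\<kappa> = (if even n \<or> (odd n \<and> [p = 1] (mod 4)) then 1 else \<i>)"
  have rhs: "(if even n \<or> (odd n \<and> [p = 1] (mod 4))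
             then \<epsilon> * zeta p powi (residue_dot p d v a + j)
             else \<epsilon> * \<i> * zeta p powi (residue_dot p d v a + j)) =
      \<epsilon> * \<kappa> * zeta p powi j * zeta p powi (\<Sum>i=1..d. a i * v i)" for \<epsilon> v a j
    unfolding residue_dot_def zeta_powi_add zeta_powi_mod[OF p0] by (simp add: \<kappa>_def mult_ac)
  show ?thesis
    unfolding gbent_def X_def[symmetric] d_def[symmetric] rhs Ha
  proof (intro ball_cong refl iffI)
    fix u assume "u \<in> X" and bent: "norm (gwht p n (p ^ k) f u) = 1"
    obtain G where G: "(ev G (zeta p))\<^sup>2 = (- 1) ^ ((p - 1) div 2) * of_nat p"
      using zeta_quadratic_root[OF odd_p] by blast
    obtain s0 :: int where s0: "s0 \<in> {1, -1}" and "c * ev G (zeta p) ^ n =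
       (if even n \<or> (odd n \<and> [p = 1] (mod 4)) then of_int s0 else of_int s0 * \<i>)"
      unfolding c_def using normalized_power_of_quadratic_root[OF odd_p G] by blast
    then have cG: "c * ev G (zeta p) ^ n = of_int s0 * \<kappa>" by (auto simp: \<kappa>_def)
    have bent': "(norm (\<Sum>x\<in>X. zeta p ^ b u x * \<zeta> ^ r x))\<^sup>2 = real p ^ n"
      using bent gb by blast
    obtain s :: int and j e where s: "s \<in> {1, -1}" and j: "j < p"
      and eq: "\<forall>\<psi>. (\<Sum>x\<in>X. zeta p ^ b u x * \<psi> (r x)) = of_int s * ev G (zeta p) ^ n * zeta p ^ j * \<psi> e"
      by (rule single_class_of_norm[OF finX r bent' G])
    \<comment> \<open>The digits of the only \<open>e\<close> whose fibre under \<open>r\<close> contributes to the sums form the vector \<open>v\<close>.\<close>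
    define v where "v = restrict (\<lambda>i. int (e div p ^ (d - i) mod p)) {1..d}"
    show "\<exists>v\<in>residue_vecs p d. \<exists>j\<in>carrier (residue_ring (int p)). \<exists>\<epsilon>\<in>{1, - 1}.
        \<forall>a\<in>residue_vecs p d. c * (\<Sum>x\<in>X. zeta p ^ b u x * zeta p powi (\<Sum>i=1..d. a i * W x i)) =
          \<epsilon> * \<kappa> * zeta p powi j * zeta p powi (\<Sum>i=1..d. a i * v i)"
    proof (intro bexI ballI)
      fix a assume "a \<in> residue_vecs p d"
      define \<psi> where "\<psi> = (\<lambda>e. zeta p powi (\<Sum>i=1..d. a i * int (e div p ^ (d - i) mod p)))"
      have "(\<Sum>x\<in>X. zeta p ^ b u x * zeta p powi (\<Sum>i=1..d. a i * W x i)) = (\<Sum>x\<in>X. zeta p ^ b u x * \<psi> (r x))"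
        unfolding \<psi>_def
      proof (intro sum.cong refl arg_cong2[where f = "(*)"] arg_cong[where f = "\<lambda>i. zeta p powi i"])
        fix x i assume "x \<in> X" "i \<in> {1..d}"
        then show "W x i = int (r x div p ^ (d - i) mod p)"
          using digit[of x i] F(1)[of i x] by (simp add: W_def)
      qed
      also have "\<dots> = of_int s * ev G (zeta p) ^ n * zeta p ^ j * \<psi> e" using eq by blast
      also have "\<psi> e = zeta p powi (\<Sum>i=1..d. a i * v i)"
        unfolding \<psi>_def v_def by (intro arg_cong[where f = "\<lambda>i. zeta p powi i"] sum.cong) auto
      finally show "c * (\<Sum>x\<in>X. zeta p ^ b u x * zeta p powi (\<Sum>i=1..d. a i * W x i)) =
          of_int (s * s0) * \<kappa> * zeta p powi (int j) * zeta p powi (\<Sum>i=1..d. a i * v i)"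
        using cG by (simp add: mult_ac)
    next
      show "v \<in> residue_vecs p d" unfolding v_def using p0 by (rule digits_in_residue_vecs)
      show "int j \<in> carrier (residue_ring (int p))" using j by (simp add: carrier_residue_ring)
      show "of_int (s * s0) \<in> {1, - 1}" using s s0 by auto
    qed
  next
    fix u assume "u \<in> X" and "\<exists>v\<in>residue_vecs p d. \<exists>j\<in>carrier (residue_ring (int p)). \<exists>\<epsilon>\<in>{1, - 1}.
        \<forall>a\<in>residue_vecs p d. c * (\<Sum>x\<in>X. zeta p ^ b u x * zeta p powi (\<Sum>i=1..d. a i * W x i)) =
          \<epsilon> * \<kappa> * zeta p powi j * zeta p powi (\<Sum>i=1..d. a i * v i)"
    then obtain v j \<epsilon> where v: "v \<in> residue_vecs p d" and \<epsilon>: "\<epsilon> \<in> {1, -1}"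
      and eq: "\<And>a. a \<in> residue_vecs p d \<Longrightarrow>
        c * (\<Sum>x\<in>X. zeta p ^ b u x * zeta p powi (\<Sum>i=1..d. a i * W x i)) =
          \<epsilon> * \<kappa> * zeta p powi j * zeta p powi (\<Sum>i=1..d. a i * v i)" by blast
    define K where "K = \<epsilon> * \<kappa> * zeta p powi j"
    \<comment> \<open>The transform of \<open>f\<close> is obtained by testing against the function that sends a digit vector to the
      corresponding power of \<open>\<zeta>\<close>.\<close>
    define g where "g = (\<lambda>w :: nat \<Rightarrow> int. \<zeta> ^ (\<Sum>i=1..d. nat (w i) * p ^ (d - i)))"
    have "(\<Sum>x\<in>X. (c * zeta p ^ b u x) * g (W x)) = K * g v"
    proof (rule character_sums_determine[OF p0 W v])
      fix a assume "a \<in> residue_vecs p d"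
      from eq[OF this] show "(\<Sum>x\<in>X. c * zeta p ^ b u x * zeta p powi (\<Sum>i=1..d. a i * W x i)) =
          K * zeta p powi (\<Sum>i=1..d. a i * v i)"
        by (simp add: K_def sum_distrib_left mult.assoc)
    qed
    moreover have "g (W x) = \<zeta> ^ r x" for x
      unfolding g_def r_def by (intro arg_cong[where f = "\<lambda>m. \<zeta> ^ m"] sum.cong) (auto simp: W_def w_def)
    ultimately have "gwht p n (p ^ k) f u = K * g v"
      unfolding H by (simp add: sum_distrib_left mult.assoc)
    then show "norm (gwht p n (p ^ k) f u) = 1"
      using \<epsilon> by (auto simp: K_def g_def \<kappa>_def norm_mult norm_power)
  qed
qed

end
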